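(* In the single-cell uplink with predicted CSI (predictor order $p$) and MRC receivers described in the context, for every $k\in\{1,\dots,K\}$ the achievable uplink rate of user $k$ satisfies $R_k^{\mathrm{p,mrc}}\ge\tilde R_k^{\mathrm{p,mrc}}$, where $$\tilde R_k^{\mathrm{p,mrc}}=\log_2\left(1+\frac{p_u(M-1)\frac1M\mathrm{tr}(\alpha^2\boldsymbol\Theta_k(p,\alpha))}{p_u\sum_{i=1,i\ne k}^K\frac1M\mathrm{tr}(\alpha^2\boldsymbol\Theta_i(p,\alpha))+p_u\sum_{i=1}^K\frac1M\mathrm{tr}(\beta_i\mathbf I_M-\alpha^2\boldsymbol\Theta_i(p,\alpha))+1}\right).$$
   Context: System: a base station (BS) with $M$ antennas and $K\le M$ single-antenna users; $p_u>0$ is the transmit power per user, $\tau\ge K$ the (integer) training length, $p_p:=\tau p_u$, and $\beta_1,\dots,\beta_K>0$ are constants. The channel of user $k$ is a stationary process $\mathbf g_k[n]\in\mathbb C^M$ with i.i.d. $\mathcal{CN}(0,\beta_k)$ entries, independent across users, satisfying $\mathbf g_k[n+1]=\alpha\mathbf g_k[n]+\mathbf e_k[n+1]$, with $\alpha$ real, $0\le|\alpha|\le1$ (convention $0^0=1$), and $\mathbf e_k[n+1]$ having i.i.d. $\mathcal{CN}(0,(1-\alpha^2)\beta_k)$ entries, independent over time and of the past. The BS observes $\tilde{\mathbf y}_k[n]=\mathbf g_k[n]+\frac1{\sqrt{p_p}}\mathbf b_k[n]$, with $\mathbf b_k[n]$ having i.i.d. $\mathcal{CN}(0,1)$ entries,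 independent over $k$ and $n$ and of the channels. Prediction: let $p\ge0$ be an integer (predictor order), $\bar{\mathbf y}_k[n]=[\tilde{\mathbf y}_k^T[n],\tilde{\mathbf y}_k^T[n-1],\dots,\tilde{\mathbf y}_k^T[n-p]]^T$, $\delta(p,\alpha)=[1\ \alpha\ \cdots\ \alpha^p]$, $\Delta(p,\alpha)$ the $(p+1)\times(p+1)$ matrix with $(i,j)$ entry $\alpha^{|i-j|}$, and $$\mathbf T_k(p,\alpha)=\beta_k[\Delta(p,\alpha)\otimes\mathbf I_M]+\tfrac1{p_p}\mathbf I_{M(p+1)}.$$ The predicted channel is $\breve{\mathbf g}_k[n+1]=\mathbf q_k\bar{\mathbf y}_k[n]$ with $\mathbf q_k=\alpha\beta_k[\delta(p,\alpha)\otimes\mathbf I_M]\mathbf T_k^{-1}(p,\alpha)$. Its covariance matrix is $\alpha^2\boldsymbol\Theta_k(p,\alpha)$, where $$\boldsymbol\Theta_k(p,\alpha)=\beta_k^2[\delta(p,\alpha)\otimes\mathbf I_M]\mathbf T_k^{-1}(p,\alpha)[\delta(p,\alpha)\otimes\mathbf I_M]^\dagger .$$ Rate: with linear detector vector $\hat{\mathbf a}_k$ and $\breve{\mathbf g}_i=\breve{\mathbf g}_i[n+1]$, the achievable rate of user $k$ is defined as $R_k^{\mathrm p}=\mathrm E\{\log_2(1+\mathrm{SINR}_k^{\mathrm p})\}$ with $$\mathrm{SINR}_k^{\mathrm p}=\frac{p_u|\hat{\mathbf a}_k^\dagger\breve{\mathbf g}_k|^2}{p_u\sum_{i\ne k}|\hat{\mathbf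 a}_k^\dagger\breve{\mathbf g}_i|^2+\|\hat{\mathbf a}_k\|^2\left(p_u\sum_{i=1}^K\frac1M\mathrm{tr}(\beta_i\mathbf I_M-\alpha^2\boldsymbol\Theta_i(p,\alpha))+1\right)},$$ read as $0$ when $\hat{\mathbf a}_k=0$. The MRC receiver is $\hat{\mathbf a}_k=\breve{\mathbf g}_k[n+1]$, and the resulting rate is denoted $R_k^{\mathrm{p,mrc}}$. *)

theory Defs
  imports "HOL-Probability.Probability" "Jordan_Normal_Form.Schur_Decomposition"
    "Jordan_Normal_Form.Gauss_Jordan_Elimination"
begin

unbundle no vec_syntax
unbundle no inner_syntax

section \<open>Matrices\<close>

text \<open>Matrix indices start at \<open>0\<close>.\<close>

definition kron :: "'a :: semiring_1 mat \<Rightarrow> 'a mat \<Rightarrow> 'a mat" where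
  "kron A B = Matrix.mat (dim_row A * dim_row B) (dim_col A * dim_col B)
     (\<lambda>(i, j). A $$ (i div dim_row B, j div dim_col B) * B $$ (i mod dim_row B, j mod dim_col B))"

definition mtrace :: "'a :: comm_monoid_add mat \<Rightarrow> 'a" where
  "mtrace A = (\<Sum>i<dim_row A. A $$ (i, i))"

definition delta_row :: "nat \<Rightarrow> real \<Rightarrow> real mat" where
  "delta_row p \<alpha> = Matrix.mat 1 (p + 1) (\<lambda>(i, j). \<alpha> ^ j)"

definition Delta_mat :: "nat \<Rightarrow> real \<Rightarrow> real mat" where
  "Delta_mat p \<alpha> = Matrix.mat (p + 1) (p + 1) (\<lambda>(i, j). \<alpha> ^ nat \<bar>int i - int j\<bar>)"

text \<open>Below, \<open>\<beta>\<close> is the large-scale coefficient of a single user and \<open>pp\<close> is the pilot power.\<close>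

definition T_mat :: "nat \<Rightarrow> nat \<Rightarrow> real \<Rightarrow> real \<Rightarrow> real \<Rightarrow> real mat" where
  "T_mat M p \<alpha> \<beta> pp =
     \<beta> \<cdot>\<^sub>m kron (Delta_mat p \<alpha>) (1\<^sub>m M) + (1 / pp) \<cdot>\<^sub>m 1\<^sub>m (M * (p + 1))"

text \<open>For \<open>\<beta>, pp > 0\<close> and \<open>\<bar>\<alpha>\<bar> \<le> 1\<close> the matrix \<open>T_mat\<close> is positive definite, so
  \<open>mat_inverse\<close> does not return \<open>None\<close> in the next two definitions.\<close>

definition q_mat :: "nat \<Rightarrow> nat \<Rightarrow> real \<Rightarrow> real \<Rightarrow> real \<Rightarrow> real mat" where
  "q_mat M p \<alpha> \<beta> pp =
     (\<alpha> * \<beta>) \<cdot>\<^sub>m (kron (delta_row p \<alpha>) (1\<^sub>m M) * the (mat_inverse (T_mat M p \<alpha> \<beta> pp)))"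

definition Theta_mat :: "nat \<Rightarrow> nat \<Rightarrow> real \<Rightarrow> real \<Rightarrow> real \<Rightarrow> real mat" where
  "Theta_mat M p \<alpha> \<beta> pp =
     \<beta>\<^sup>2 \<cdot>\<^sub>m (kron (delta_row p \<alpha>) (1\<^sub>m M) * the (mat_inverse (T_mat M p \<alpha> \<beta> pp))
           * mat_adjoint (kron (delta_row p \<alpha>) (1\<^sub>m M)))"

definition vec_sq_norm :: "complex Matrix.vec \<Rightarrow> real" where
  "vec_sq_norm v = (\<Sum>i<dim_vec v. (cmod (v $ i))\<^sup>2)"


section \<open>Circularly symmetric complex Gaussian law\<close>

text \<open>Real and imaginary parts are independent and centred, each of variance \<open>v / 2\<close>. Scaling a
  standard Gaussian pair makes \<open>v = 0\<close> the point mass at \<open>0\<close>, which is needed for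
  \<open>\<bar>\<alpha>\<bar> = 1\<close>.\<close>

definition complex_gaussian :: "real \<Rightarrow> complex measure" where
  "complex_gaussian v =
     distr (density lborel std_normal_density \<Otimes>\<^sub>M density lborel std_normal_density) borel
       (\<lambda>(x, y). Complex (sqrt (v / 2) * x) (sqrt (v / 2) * y))"

definition (in prob_space) has_cn_law :: "('a \<Rightarrow> complex) \<Rightarrow> real \<Rightarrow> bool" where
  "has_cn_law X v \<longleftrightarrow> random_variable borel X \<and> distr M borel X = complex_gaussian v"


section \<open>System model\<close>

text \<open>Users are numbered \<open>1, \<dots>, K\<close>, antennas \<open>0, \<dots>, M - 1\<close>, and time is doubly infinite.
  \<open>g k n m\<close> is entry \<open>m\<close> of the channel of user \<open>k\<close> at time \<open>n\<close>, and similarly for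
  the innovation \<open>e\<close> and the noise \<open>b\<close>.\<close>

locale uplink = prob_space P for P :: "'w measure" +
  fixes M K tau :: nat and pu \<alpha> :: real and \<beta> :: "nat \<Rightarrow> real"
    and g e b :: "nat \<Rightarrow> int \<Rightarrow> nat \<Rightarrow> 'w \<Rightarrow> complex"
  assumes K_le_M: "K \<le> M"
    and K_le_tau: "K \<le> tau"
    and pu_pos: "0 < pu"
    and beta_pos: "\<And>k. k \<in> {1..K} \<Longrightarrow> 0 < \<beta> k"
    and alpha_le_1: "\<bar>\<alpha>\<bar> \<le> 1"
    and g_law: "\<And>k n m. k \<in> {1..K} \<Longrightarrow> m < M \<Longrightarrow> has_cn_law (g k n m) (\<beta> k)"
    and g_indep_entries: "\<And>k n. k \<in> {1..K} \<Longrightarrow> indep_vars (\<lambda>_. borel) (g k n) {..<M}"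
    and g_indep_users:
      "indep_vars (\<lambda>_. \<Pi>\<^sub>M i\<in>UNIV \<times> {..<M}. borel)
         (\<lambda>k \<omega>. \<lambda>(n, m)\<in>UNIV \<times> {..<M}. g k n m \<omega>) {1..K}"
    and g_stationary:
      "\<And>k h. k \<in> {1..K} \<Longrightarrow>
         distr P (\<Pi>\<^sub>M i\<in>UNIV \<times> {..<M}. borel)
           (\<lambda>\<omega>. \<lambda>(n, m)\<in>UNIV \<times> {..<M}. g k (n + h) m \<omega>) =
         distr P (\<Pi>\<^sub>M i\<in>UNIV \<times> {..<M}. borel)
           (\<lambda>\<omega>. \<lambda>(n, m)\<in>UNIV \<times> {..<M}. g k n m \<omega>)"
    and g_step:
      "\<And>k n m \<omega>. k \<in> {1..K} \<Longrightarrow> m < M \<Longrightarrow> \<omega> \<in> space P \<Longrightarrow>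
         g k (n + 1) m \<omega> = of_real \<alpha> * g k n m \<omega> + e k (n + 1) m \<omega>"
    and e_law:
      "\<And>k n m. k \<in> {1..K} \<Longrightarrow> m < M \<Longrightarrow> has_cn_law (e k n m) ((1 - \<alpha>\<^sup>2) * \<beta> k)"
    and e_indep_entries: "\<And>k n. k \<in> {1..K} \<Longrightarrow> indep_vars (\<lambda>_. borel) (e k n) {..<M}"
    and e_indep_time:
      "\<And>k. k \<in> {1..K} \<Longrightarrow>
         indep_vars (\<lambda>_. \<Pi>\<^sub>M m\<in>{..<M}. borel) (\<lambda>n \<omega>. \<lambda>m\<in>{..<M}. e k n m \<omega>) UNIV"
    and e_indep_past:
      "\<And>k n. k \<in> {1..K} \<Longrightarrow>
         indep_var
           (\<Pi>\<^sub>M i\<in>{n + 1} \<times> {..<M}. borel) (\<lambda>\<omega>. \<lambda>(j, m)\<in>{n + 1} \<times> {..<M}. e k j m \<omega>)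
           (\<Pi>\<^sub>M i\<in>{..n} \<times> {..<M}. borel) (\<lambda>\<omega>. \<lambda>(j, m)\<in>{..n} \<times> {..<M}. g k j m \<omega>)"
    and b_law: "\<And>k n m. k \<in> {1..K} \<Longrightarrow> m < M \<Longrightarrow> has_cn_law (b k n m) 1"
    and b_indep:
      "indep_vars (\<lambda>_. borel) (\<lambda>(k, n, m). b k n m) ({1..K} \<times> UNIV \<times> {..<M})"
    and b_indep_g:
      "indep_var
         (\<Pi>\<^sub>M i\<in>{1..K} \<times> UNIV \<times> {..<M}. borel)
           (\<lambda>\<omega>. \<lambda>(k, n, m)\<in>{1..K} \<times> UNIV \<times> {..<M}. b k n m \<omega>)
         (\<Pi>\<^sub>M i\<in>{1..K} \<times> UNIV \<times> {..<M}. borel)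
           (\<lambda>\<omega>. \<lambda>(k, n, m)\<in>{1..K} \<times> UNIV \<times> {..<M}. g k n m \<omega>)"
begin

definition pp :: real where
  "pp = real tau * pu"

definition y_obs :: "nat \<Rightarrow> int \<Rightarrow> 'w \<Rightarrow> complex Matrix.vec" where
  "y_obs k n \<omega> = Matrix.vec M (\<lambda>m. g k n m \<omega> + of_real (1 / sqrt pp) * b k n m \<omega>)"

text \<open>Block \<open>j\<close> of the stacked vector is the observation at time \<open>n - j\<close>.\<close>

definition y_stack :: "nat \<Rightarrow> nat \<Rightarrow> int \<Rightarrow> 'w \<Rightarrow> complex Matrix.vec" where
  "y_stack p k n \<omega> =
     Matrix.vec (M * (p + 1)) (\<lambda>i. y_obs k (n - int (i div M)) \<omega> $ (i mod M))"

definition \<Theta> :: "nat \<Rightarrow> nat \<Rightarrow> real mat" where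
  "\<Theta> p k = Theta_mat M p \<alpha> (\<beta> k) pp"

text \<open>\<open>g_pred p k n\<close> is the prediction of the channel at time \<open>n\<close> from the observations at times
  \<open>n - 1, \<dots>, n - 1 - p\<close>.\<close>

definition g_pred :: "nat \<Rightarrow> nat \<Rightarrow> int \<Rightarrow> 'w \<Rightarrow> complex Matrix.vec" where
  "g_pred p k n \<omega> =
     map_mat complex_of_real (q_mat M p \<alpha> (\<beta> k) pp) *\<^sub>v y_stack p k (n - 1) \<omega>"

text \<open>The product \<open>x \<bullet>c a\<close> conjugates its second argument, so it is \<open>a\<^sup>\<dagger> x\<close>. For \<open>a = 0\<close> the
  quotient is \<open>0 / 0 = 0\<close>.\<close>

definition SINR :: "nat \<Rightarrow> nat \<Rightarrow> int \<Rightarrow> complex Matrix.vec \<Rightarrow> 'w \<Rightarrow> real" where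
  "SINR p k n a \<omega> =
     pu * (cmod (g_pred p k n \<omega> \<bullet>c a))\<^sup>2 /
     (pu * (\<Sum>i\<in>{1..K} - {k}. (cmod (g_pred p i n \<omega> \<bullet>c a))\<^sup>2) +
      vec_sq_norm a *
        (pu * (\<Sum>i\<in>{1..K}. 1 / real M * mtrace (\<beta> i \<cdot>\<^sub>m 1\<^sub>m M - \<alpha>\<^sup>2 \<cdot>\<^sub>m \<Theta> p i)) + 1))"

definition rate :: "nat \<Rightarrow> nat \<Rightarrow> int \<Rightarrow> ('w \<Rightarrow> complex Matrix.vec) \<Rightarrow> real" where
  "rate p k n a = expectation (\<lambda>\<omega>. log 2 (1 + SINR p k n (a \<omega>) \<omega>))"

definition rate_mrc :: "nat \<Rightarrow> nat \<Rightarrow> int \<Rightarrow> real" where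
  "rate_mrc p k n = rate p k n (g_pred p k n)"

definition rate_mrc_bound :: "nat \<Rightarrow> nat \<Rightarrow> real" where
  "rate_mrc_bound p k =
     log 2 (1 +
       pu * (real M - 1) * (1 / real M) * mtrace (\<alpha>\<^sup>2 \<cdot>\<^sub>m \<Theta> p k) /
       (pu * (\<Sum>i\<in>{1..K} - {k}. 1 / real M * mtrace (\<alpha>\<^sup>2 \<cdot>\<^sub>m \<Theta> p i)) +
        pu * (\<Sum>i\<in>{1..K}. 1 / real M * mtrace (\<beta> i \<cdot>\<^sub>m 1\<^sub>m M - \<alpha>\<^sup>2 \<cdot>\<^sub>m \<Theta> p i)) + 1))"

end

end

theory Submission
  imports Defs
begin

text \<open>Each predicted channel entry is a linear combination of independent Gaussians; the normal
  equations of the predictor turn its variance into \<open>\<sigma>\<^sub>i = \<alpha>\<^sup>2 \<theta>\<^sub>i\<close>, where \<open>\<Theta>\<^sub>i = \<theta>\<^sub>i I\<close>, and positive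
  semidefiniteness of \<open>\<Delta>\<close> gives \<open>\<theta>\<^sub>i \<le> \<beta>\<^sub>i\<close>. The predictions are independent over users, with
  i.i.d. entries of variance \<open>\<sigma>\<^sub>i\<close>. Since \<open>x \<mapsto> log(1 + 1/x)\<close> is convex, it suffices to bound the
  mean of \<open>1/SINR\<close>. Conditioning on the prediction \<open>a\<close> of user \<open>k\<close>, each interference term
  \<open>\<bar>a\<^sup>\<dagger> g\<^sub>i\<bar>\<^sup>2 / \<parallel>a\<parallel>\<^sup>4\<close> has mean \<open>\<sigma>\<^sub>i / \<parallel>a\<parallel>\<^sup>2\<close>, so everything reduces to
  \<open>E(1/\<parallel>a\<parallel>\<^sup>2) = 1 / ((M - 1) \<sigma>\<^sub>k)\<close>.\<close>

section \<open>Centred normal laws and independence\<close>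

text \<open>The factor \<open>M - 1\<close> comes from counting real coordinates. A vector of M
  complex entries of variance \<sigma> has 2M real ones of variance \<sigma>/2, so the Laplace
  transform of its squared norm is \<open>1 / (1 + \<sigma> * s) ^ M\<close>, with integral
  \<open>1 / ((M - 1) * \<sigma>)\<close> over s \<ge> 0. This diverges for M = 1, and \<sigma>
  vanishes for \<alpha> = 0; in both cases the bound is \<open>log 2 1 = 0\<close> and nonnegativity
  of the rate is enough.

  For one user the channel hypotheses concern entries at a single time and an innovation against the
  past; no joint Gaussian law over time is stated. It is recovered by removing one sample at a time
  through the recursion, and the same elimination shows that \<Delta> is positive semidefinite.

  Variance 0 is legitimate (innovations for \<bar>\<alpha>\<bar> = 1, predictions for \<alpha> = 0).
  Hence normal laws are scaled copies of the standard one and are identified by characteristic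
  functions, not by densities.

  The expectation of a non-integrable function is 0 by convention, so a lower bound on a rate also
  needs integrability. It follows from SINR being at most a constant times the squared norm of the
  prediction.\<close>

definition centred_normal :: "real \<Rightarrow> real measure" where
  "centred_normal v = distr std_normal_distribution borel ((*) (sqrt v))"

lemma prob_space_std_normal_distribution: "prob_space std_normal_distribution"
  by (rule prob_space_normal_density) simp

lemma real_distribution_centred_normal: "real_distribution (centred_normal v)"
  unfolding centred_normal_def
  by (rule prob_space.real_distribution_distr[OF prob_space_std_normal_distribution]) simp

lemma sets_centred_normal [measurable_cong, simp]: "sets (centred_normal v) = sets borel"
  and space_centred_normal [simp]: "space (centred_normal v) = UNIV"
  by (simp_all add: centred_normal_def)

lemma char_centred_normal:
  assumes "0 \<le> v"
  shows "char (centred_normal v) t = complex_of_real (exp (- (v * t\<^sup>2) / 2))"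
proof -
  have "char (centred_normal v) t = char std_normal_distribution (t * sqrt v)"
    unfolding char_def centred_normal_def by (subst integral_distr) (auto simp: mult.assoc)
  also have "\<dots> = complex_of_real (exp (- (v * t\<^sup>2) / 2))"
    using assms by (simp add: char_std_normal_distribution power_mult_distrib mult.commute)
  finally show ?thesis .
qed

lemma nn_integral_square_centred_normal:
  assumes "0 \<le> v"
  shows "(\<integral>\<^sup>+x. ennreal (x\<^sup>2) \<partial>centred_normal v) = ennreal v"
proof -
  have "(\<integral>\<^sup>+x. ennreal (x\<^sup>2) \<partial>centred_normal v) =
      (\<integral>\<^sup>+x. ennreal (v * x\<^sup>2) \<partial>std_normal_distribution)"
    unfolding centred_normal_def using assms
    by (subst nn_integral_distr) (auto simp: power_mult_distrib)
  also have "\<dots> = ennreal v"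
    using assms std_normal_distribution_even_moments[of 1]
    by (subst nn_integral_eq_integral) simp_all
  finally show ?thesis .
qed

text \<open>Tilting the standard density by the exponential gives a multiple of another centred
  normal density, whose mass is 1. As a function of \<open>s\<close> this is the Laplace transform
  of a squared Gaussian.\<close>

lemma nn_integral_exp_square_centred_normal:
  assumes "0 \<le> v" "0 \<le> s"
  shows "(\<integral>\<^sup>+x. ennreal (exp (- (s * x\<^sup>2))) \<partial>centred_normal v) = ennreal (1 / sqrt (1 + 2 * s * v))"
proof -
  \<comment> \<open>The tilted exponent is \<open>- (d * x^2) / 2\<close>, so \<open>d\<close> is
    the reciprocal variance of the tilted law.\<close>
  define d where "d = 1 + 2 * s * v"
  have d: "0 < d" "1 / sqrt d > 0" using assms by (auto simp: d_def add_pos_nonneg)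
  have "(\<integral>\<^sup>+x. ennreal (exp (- (s * x\<^sup>2))) \<partial>centred_normal v) =
      (\<integral>\<^sup>+x. ennreal (std_normal_density x) * ennreal (exp (- (s * v * x\<^sup>2))) \<partial>lborel)"
    unfolding centred_normal_def using assms
    by (subst nn_integral_distr, simp, simp, subst nn_integral_density)
       (auto simp: power_mult_distrib mult.assoc)
  also have "\<dots> = (\<integral>\<^sup>+x. ennreal (1 / sqrt d) * ennreal (normal_density 0 (1 / sqrt d) x) \<partial>lborel)"
  proof (rule nn_integral_cong)
    fix x :: real
    have "std_normal_density x * exp (- (s * v * x\<^sup>2)) =
        1 / sqrt (2 * pi) * exp (- x\<^sup>2 / 2 + - (s * v * x\<^sup>2))"
      by (simp only: std_normal_density_def exp_add mult.assoc)
    also have "\<dots> = 1 / sqrt (2 * pi) * exp (- (d * x\<^sup>2) / 2)"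
      by (simp add: d_def algebra_simps add_divide_distrib)
    also have "\<dots> = 1 / sqrt d * normal_density 0 (1 / sqrt d) x"
      using d by (simp add: normal_density_def power_divide real_sqrt_divide real_sqrt_mult field_simps)
    finally show "ennreal (std_normal_density x) * ennreal (exp (- (s * v * x\<^sup>2))) =
        ennreal (1 / sqrt d) * ennreal (normal_density 0 (1 / sqrt d) x)"
      using d by (simp add: ennreal_mult'[symmetric])
  qed
  also have "\<dots> = ennreal (1 / sqrt d)"
    using d(1) by (subst nn_integral_cmult) (simp_all add: nn_integral_eq_integral)
  finally show ?thesis by (simp add: d_def)
qed

context prob_space begin

definition indep_normal :: "('i \<Rightarrow> 'a \<Rightarrow> real) \<Rightarrow> 'i set \<Rightarrow> real \<Rightarrow> bool" where
  "indep_normal X I v \<longleftrightarrow>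
     indep_vars (\<lambda>_. borel) X I \<and> (\<forall>i\<in>I. distr M borel (X i) = centred_normal v)"

text \<open>Characteristic functions treat zero variances and zero coefficients like all others; a
  convolution of densities would break down there.\<close>

lemma distr_normal_linear_combination:
  assumes ind: "indep_vars (\<lambda>_. borel) Z L"
    and law: "\<And>l. l \<in> L \<Longrightarrow> distr M borel (Z l) = centred_normal (v l)"
    and v: "\<And>l. l \<in> L \<Longrightarrow> 0 \<le> v l"
    and fin: "finite L"
  shows "distr M borel (\<lambda>\<omega>. \<Sum>l\<in>L. c l * Z l \<omega>) = centred_normal (\<Sum>l\<in>L. (c l)\<^sup>2 * v l)"
proof (rule Levy_uniqueness)
  have rv[measurable]: "\<And>l. l \<in> L \<Longrightarrow> random_variable borel (Z l)"
    using ind by (auto simp: indep_vars_def)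
  show "real_distribution (distr M borel (\<lambda>\<omega>. \<Sum>l\<in>L. c l * Z l \<omega>))"
    by (rule real_distribution_distr) measurable
  show "real_distribution (centred_normal (\<Sum>l\<in>L. (c l)\<^sup>2 * v l))"
    by (rule real_distribution_centred_normal)
  have ind': "indep_vars (\<lambda>_. borel) (\<lambda>l \<omega>. c l * Z l \<omega>) L"
    by (rule indep_vars_compose2[OF ind]) simp
  show "char (distr M borel (\<lambda>\<omega>. \<Sum>l\<in>L. c l * Z l \<omega>)) = char (centred_normal (\<Sum>l\<in>L. (c l)\<^sup>2 * v l))"
  proof
    fix t
    have "char (distr M borel (\<lambda>\<omega>. c l * Z l \<omega>)) t = complex_of_real (exp (- ((c l)\<^sup>2 * v l * t\<^sup>2) / 2))"
      if l: "l \<in> L" for l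
    proof -
      have "char (distr M borel (\<lambda>\<omega>. c l * Z l \<omega>)) t = char (distr M borel (Z l)) (t * c l)"
        using rv[OF l] unfolding char_def by (simp add: integral_distr mult.assoc)
      then show ?thesis
        by (simp add: law[OF l] char_centred_normal[OF v[OF l]] power_mult_distrib mult_ac)
    qed
    then show "char (distr M borel (\<lambda>\<omega>. \<Sum>l\<in>L. c l * Z l \<omega>)) t =
        char (centred_normal (\<Sum>l\<in>L. (c l)\<^sup>2 * v l)) t"
      using v by (simp add: char_distr_sum[OF ind'] char_centred_normal sum_nonneg
          sum_distrib_right sum_divide_distrib exp_sum[OF fin] flip: of_real_prod sum_negf)
  qed
qed

text \<open>By injectivity the singletons \<open>{f j}\<close> are disjoint blocks, and disjoint
  blocks of an independent family are independent.\<close>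

lemma indep_vars_reindex:
  assumes ind: "indep_vars N X I" and f: "inj_on f J" "f ` J \<subseteq> I"
  shows "indep_vars (\<lambda>j. N (f j)) (\<lambda>j. X (f j)) J"
proof -
  have "indep_vars (\<lambda>j. PiM {f j} N) (\<lambda>j \<omega>. restrict (\<lambda>i. X i \<omega>) {f j}) J"
    by (rule indep_vars_restrict[OF ind]) (use f in \<open>auto simp: disjoint_family_on_def inj_on_def\<close>)
  from indep_vars_compose2[OF this, of "\<lambda>j x. x (f j)" "\<lambda>j. N (f j)"]
  show ?thesis by simp
qed

text \<open>The converse of grouping into blocks. A finite index set \<open>J\<close> splits into
  columns \<open>H k\<close>; the event of a column is the preimage of a cylinder
  \<open>C k\<close>, so \<open>outer\<close> factors the probability over \<open>k\<close> and
  \<open>inner\<close> factors each column over \<open>i\<close>.\<close>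

lemma indep_vars_Sigma:
  assumes outer: "indep_vars (\<lambda>k. PiM (I k) (N k)) (\<lambda>k \<omega>. \<lambda>i\<in>I k. X k i \<omega>) K"
    and inner: "\<And>k. k \<in> K \<Longrightarrow> indep_vars (N k) (X k) (I k)"
  shows "indep_vars (\<lambda>(k, i). N k i) (\<lambda>(k, i). X k i) (Sigma K I)"
  unfolding indep_vars_def2
proof (intro conjI indep_setsI)
  have rv: "random_variable (N k i) (X k i)" if "k \<in> K" "i \<in> I k" for k i
    using inner[OF that(1)] that(2) by (auto simp: indep_vars_def)
  then show rv': "\<forall>j\<in>Sigma K I. random_variable ((\<lambda>(k, i). N k i) j) ((\<lambda>(k, i). X k i) j)"
    by auto
  then show "{(\<lambda>(k, i). X k i) j -` A \<inter> space M |A. A \<in> sets ((\<lambda>(k, i). N k i) j)} \<subseteq> events"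
    if "j \<in> Sigma K I" for j
    using that rv by (auto intro: measurable_sets)
  fix A J
  assume J: "J \<noteq> {}" "J \<subseteq> Sigma K I" "finite J"
    and A: "\<forall>j\<in>J. A j \<in> {(\<lambda>(k, i). X k i) j -` A \<inter> space M |A. A \<in> sets ((\<lambda>(k, i). N k i) j)}"
  from A have "\<forall>j\<in>J. \<exists>B. A j = X (fst j) (snd j) -` B \<inter> space M \<and> B \<in> sets (N (fst j) (snd j))"
    by (auto simp: split_beta)
  then obtain B where B: "\<And>j. j \<in> J \<Longrightarrow> A j = X (fst j) (snd j) -` B j \<inter> space M"
      "\<And>j. j \<in> J \<Longrightarrow> B j \<in> sets (N (fst j) (snd j))"
    by metis
  define L where "L = fst ` J"
  define H where "H k = {i. (k, i) \<in> J}" for k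
  have H: "finite (H k)" "H k \<subseteq> I k" "k \<in> L \<Longrightarrow> H k \<noteq> {}" for k
  proof -
    have "H k = snd ` (J \<inter> {k} \<times> UNIV)" by (force simp: H_def)
    then show "finite (H k)" using J(3) by auto
  qed (use J(2) in \<open>auto simp: H_def L_def\<close>)
  have L: "L \<noteq> {}" "finite L" "L \<subseteq> K" using J by (auto simp: L_def)
  have JS: "J = Sigma L H" by (force simp: L_def H_def)
  define C where "C k = {f \<in> space (PiM (I k) (N k)). \<forall>i\<in>H k. f i \<in> B (k, i)}" for k
  have C: "C k \<in> sets (PiM (I k) (N k))" if k: "k \<in> L" for k
  proof -
    have [measurable]: "i \<in> H k \<Longrightarrow> B (k, i) \<in> sets (N k i)" "i \<in> H k \<Longrightarrow> i \<in> I k" for i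
      using B(2)[of "(k, i)"] H(2)[of k] by (auto simp: H_def)
    show ?thesis unfolding C_def using H(1)[of k] by measurable
  qed
  \<comment> \<open>Nonemptiness of \<open>H k\<close> matters: it keeps the right side inside
    \<open>space M\<close>, whereas an empty intersection would be \<open>UNIV\<close>.\<close>
  have pre: "(\<lambda>\<omega>. \<lambda>i\<in>I k. X k i \<omega>) -` C k \<inter> space M = (\<Inter>i\<in>H k. X k i -` B (k, i) \<inter> space M)"
    if k: "k \<in> L" for k
    using H(2,3)[of k] k L(3) rv measurable_space[OF rv]
    by (auto simp: C_def space_PiM PiE_def Pi_def subset_iff)
  have "(\<Inter>j\<in>J. A j) = (\<Inter>k\<in>L. \<Inter>i\<in>H k. X k i -` B (k, i) \<inter> space M)"
  proof -
    have "(\<Inter>j\<in>J. A j) = (\<Inter>j\<in>Sigma L H. X (fst j) (snd j) -` B j \<inter> space M)"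
      using B(1) JS by (intro INF_cong) auto
    also have "\<dots> = (\<Inter>k\<in>L. \<Inter>i\<in>H k. X k i -` B (k, i) \<inter> space M)"
      by (rule Set.set_eqI) (simp only: INT_iff Ball_def split_paired_All mem_Sigma_iff fst_conv snd_conv, blast)
    finally show ?thesis .
  qed
  also have "\<dots> = (\<Inter>k\<in>L. (\<lambda>\<omega>. \<lambda>i\<in>I k. X k i \<omega>) -` C k \<inter> space M)"
    using pre by simp
  also have "prob \<dots> = (\<Prod>k\<in>L. prob ((\<lambda>\<omega>. \<lambda>i\<in>I k. X k i \<omega>) -` C k \<inter> space M))"
    by (rule indep_varsD[OF outer L]) (rule C)
  also have "\<dots> = (\<Prod>k\<in>L. \<Prod>i\<in>H k. prob (X k i -` B (k, i) \<inter> space M))"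
  proof (rule prod.cong[OF refl])
    fix k assume k: "k \<in> L"
    show "prob ((\<lambda>\<omega>. \<lambda>i\<in>I k. X k i \<omega>) -` C k \<inter> space M) = (\<Prod>i\<in>H k. prob (X k i -` B (k, i) \<inter> space M))"
      unfolding pre[OF k]
      by (rule indep_varsD[OF inner]) (use k L(3) H[of k] B(2)[of "(k, _)"] in \<open>auto simp: H_def\<close>)
  qed
  also have "\<dots> = (\<Prod>j\<in>J. prob (A j))"
    unfolding JS using H(1) L(2) B(1) JS by (subst prod.Sigma) (auto intro!: prod.cong)
  finally show "prob (\<Inter>j\<in>J. A j) = (\<Prod>j\<in>J. prob (A j))" .
qed

text \<open>Column \<open>i\<close> uses only its own block \<open>L \<times> {i}\<close> of the
  array, so the sums are independent over \<open>i\<close>; coefficients and variances depend on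
  \<open>l\<close> alone, so all columns share one law.\<close>

lemma indep_normal_linear_combination:
  assumes ind: "indep_vars (\<lambda>_. borel) (\<lambda>(l, i). Z l i) (L \<times> I)"
    and law: "\<And>l i. l \<in> L \<Longrightarrow> i \<in> I \<Longrightarrow> distr M borel (Z l i) = centred_normal (v l)"
    and v: "\<And>l. l \<in> L \<Longrightarrow> 0 \<le> v l"
    and fin: "finite L"
  shows "indep_normal (\<lambda>i \<omega>. \<Sum>l\<in>L. c l * Z l i \<omega>) I (\<Sum>l\<in>L. (c l)\<^sup>2 * v l)"
  unfolding indep_normal_def
proof (intro conjI ballI)
  have "indep_vars (\<lambda>i. \<Pi>\<^sub>M j\<in>L \<times> {i}. borel)
      (\<lambda>i \<omega>. restrict (\<lambda>j. (case j of (l, i) \<Rightarrow> Z l i) \<omega>) (L \<times> {i})) I"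
    by (rule indep_vars_restrict[OF ind]) (auto simp: disjoint_family_on_def)
  from indep_vars_compose2[OF this, of "\<lambda>i f. \<Sum>l\<in>L. c l * f (l, i)" "\<lambda>_. borel"]
  show "indep_vars (\<lambda>_. borel) (\<lambda>i \<omega>. \<Sum>l\<in>L. c l * Z l i \<omega>) I"
    by (simp cong: indep_vars_cong)
next
  fix i assume i: "i \<in> I"
  have "indep_vars (\<lambda>_. borel) (\<lambda>l. Z l i) L"
    using indep_vars_reindex[OF ind, of "\<lambda>l. (l, i)" L] i by (auto simp: inj_on_def)
  then show "distr M borel (\<lambda>\<omega>. \<Sum>l\<in>L. c l * Z l i \<omega>) = centred_normal (\<Sum>l\<in>L. (c l)\<^sup>2 * v l)"
    by (rule distr_normal_linear_combination) (use law i v fin in auto)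
qed
end

text \<open>Selecting the part by a \<open>bool\<close> turns a complex family over \<open>I\<close>
  into a real family over \<open>I \<times> UNIV\<close>, to which the real lemmas apply.\<close>

definition re_im :: "bool \<Rightarrow> complex \<Rightarrow> real" where
  "re_im r z = (if r then Re z else Im z)"

lemma re_im_measurable [measurable]: "re_im r \<in> borel_measurable borel"
  by (cases r) (simp_all add: re_im_def[abs_def])

lemma re_im_linear [simp]:
  "re_im r (x + y) = re_im r x + re_im r y"
  "re_im r (complex_of_real c * x) = c * re_im r x"
  "re_im r (sum f A) = (\<Sum>a\<in>A. re_im r (f a))"
  by (auto simp: re_im_def)

lemma centred_normal_half:
  "centred_normal (v / 2) = distr std_normal_distribution borel (\<lambda>x. sqrt (v / 2) * x)"
  by (simp add: centred_normal_def)

context prob_space begin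

text \<open>Equality is required only on the sample space because the channel recursion
  \<open>g_step\<close> holds only there.\<close>

lemma indep_normal_cong:
  assumes X: "indep_normal X I v" and eq: "\<And>i \<omega>. i \<in> I \<Longrightarrow> \<omega> \<in> space M \<Longrightarrow> X i \<omega> = Y i \<omega>"
  shows "indep_normal Y I v"
proof -
  have "indep_vars (\<lambda>_. borel) Y I"
  proof -
    have "random_variable borel (X i) = random_variable borel (Y i)" if "i \<in> I" for i
      by (rule measurable_cong) (use eq that in auto)
    moreover have "X i -` A \<inter> space M = Y i -` A \<inter> space M" if "i \<in> I" for i and A :: "real set"
      using eq that by auto
    ultimately show ?thesis
      using X unfolding indep_normal_def indep_vars_def2
      by (auto cong: indep_sets_cong)
  qed
  moreover have "distr M borel (Y i) = distr M borel (X i)" if "i \<in> I" for i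
    by (rule distr_cong) (use eq that in auto)
  ultimately show ?thesis using X by (simp add: indep_normal_def)
qed

lemma indep_normal_rv: "indep_normal X I v \<Longrightarrow> i \<in> I \<Longrightarrow> random_variable borel (X i)"
  by (auto simp: indep_normal_def indep_vars_def)

text \<open>The vectors \<open>X\<close> and \<open>Y\<close> become two rows of an array indexed by
  \<open>bool\<close>. Independent rows with independent entries make the whole array independent,
  and the claim is a linear combination over the two rows.\<close>

lemma indep_normal_add:
  assumes ind: "indep_var (\<Pi>\<^sub>M i\<in>I. borel) (\<lambda>\<omega>. \<lambda>i\<in>I. X i \<omega>) (\<Pi>\<^sub>M i\<in>I. borel) (\<lambda>\<omega>. \<lambda>i\<in>I. Y i \<omega>)"
    and X: "indep_normal X I v" "0 \<le> v" and Y: "indep_normal Y I w" "0 \<le> w"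
  shows "indep_normal (\<lambda>i \<omega>. c * X i \<omega> + d * Y i \<omega>) I (c\<^sup>2 * v + d\<^sup>2 * w)"
proof -
  have "indep_vars (\<lambda>l. \<Pi>\<^sub>M i\<in>I. borel) (\<lambda>l \<omega>. \<lambda>i\<in>I. (case_bool X Y l) i \<omega>) UNIV"
    using ind unfolding indep_var_def
    by (rule indep_vars_cong[THEN iffD1, rotated -1]) (auto split: bool.split)
  from this have "indep_vars (\<lambda>(l, i). borel) (\<lambda>(l, i). case_bool X Y l i) (UNIV \<times> I)"
    by (rule indep_vars_Sigma) (use X Y in \<open>auto simp: indep_normal_def split: bool.split\<close>)
  then have "indep_vars (\<lambda>_. borel) (\<lambda>(l, i). case_bool X Y l i) (UNIV \<times> I)"
    by (simp add: split_beta')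
  then have "indep_normal (\<lambda>i \<omega>. \<Sum>l\<in>UNIV. case_bool c d l * case_bool X Y l i \<omega>) I
      (\<Sum>l\<in>UNIV. (case_bool c d l)\<^sup>2 * case_bool v w l)"
    by (rule indep_normal_linear_combination)
      (use X Y in \<open>auto simp: indep_normal_def split: bool.split\<close>)
  then show ?thesis by (simp add: UNIV_bool add.commute)
qed

lemma indep_normal_cmult:
  assumes X: "indep_normal X I v" "0 \<le> v"
  shows "indep_normal (\<lambda>i \<omega>. c * X i \<omega>) I (c\<^sup>2 * v)"
proof -
  have "indep_vars (\<lambda>_. borel) (\<lambda>j. X (snd j)) ({()} \<times> I)"
    by (rule indep_vars_reindex[of "\<lambda>_. borel" X I]) (use X in \<open>auto simp: indep_normal_def inj_on_def\<close>)
  then have "indep_vars (\<lambda>_. borel) (\<lambda>(l, i). X i) ({()} \<times> I)"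
    by (simp add: split_beta')
  from indep_normal_linear_combination[OF this, of "\<lambda>_. v" "\<lambda>_. c"]
  show ?thesis using X by (auto simp: indep_normal_def)
qed

text \<open>The joint law of the two parts is a product measure, read off from the defining pair of
  scaled standard normals. Its marginals are then known, and a joint law equal to the product of the
  marginals is independence.\<close>

lemma has_cn_law_parts:
  assumes X: "has_cn_law X v"
  shows "indep_normal (\<lambda>r \<omega>. re_im r (X \<omega>)) UNIV (v / 2)"
proof -
  let ?N = std_normal_distribution and ?s = "sqrt (v / 2)"
  have [measurable]: "random_variable borel X"
    and law: "distr M borel X = complex_gaussian v"
    using X by (auto simp: has_cn_law_def)
  interpret C: real_distribution "centred_normal (v / 2)" by (rule real_distribution_centred_normal)
  interpret C2: pair_prob_space "centred_normal (v / 2)" "centred_normal (v / 2)" ..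
  have [measurable]: "(\<lambda>(x, y). Complex (?s * x) (?s * y)) \<in> borel_measurable (?N \<Otimes>\<^sub>M ?N)"
    by (simp add: Complex_eq split_beta)
  have joint: "distr M (borel \<Otimes>\<^sub>M borel) (\<lambda>\<omega>. (Re (X \<omega>), Im (X \<omega>))) =
      centred_normal (v / 2) \<Otimes>\<^sub>M centred_normal (v / 2)"
  proof -
    have "distr M (borel \<Otimes>\<^sub>M borel) (\<lambda>\<omega>. (Re (X \<omega>), Im (X \<omega>))) =
        distr (distr M borel X) (borel \<Otimes>\<^sub>M borel) (\<lambda>z. (Re z, Im z))"
      by (subst distr_distr) (simp_all add: comp_def)
    also have "\<dots> = distr (?N \<Otimes>\<^sub>M ?N) (borel \<Otimes>\<^sub>M borel) (\<lambda>(x, y). (?s * x, ?s * y))"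
      unfolding law complex_gaussian_def by (subst distr_distr) (simp_all add: comp_def split_beta')
    also have "\<dots> = centred_normal (v / 2) \<Otimes>\<^sub>M centred_normal (v / 2)"
      unfolding centred_normal_half
      by (rule pair_measure_distr[symmetric])
        (use C.sigma_finite_measure_axioms in \<open>simp_all add: centred_normal_half\<close>)
    finally show ?thesis .
  qed
  have "distr M borel (\<lambda>\<omega>. Re (X \<omega>)) = distr (distr M (borel \<Otimes>\<^sub>M borel) (\<lambda>\<omega>. (Re (X \<omega>), Im (X \<omega>)))) borel fst"
    by (subst distr_distr) (simp_all add: comp_def)
  also have "\<dots> = distr (centred_normal (v / 2) \<Otimes>\<^sub>M centred_normal (v / 2)) (centred_normal (v / 2)) fst"
    unfolding joint by (rule distr_cong) simp_all
  also have "\<dots> = centred_normal (v / 2)" by (rule C.distr_pair_fst)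
  finally have re: "distr M borel (\<lambda>\<omega>. Re (X \<omega>)) = centred_normal (v / 2)" .
  have "distr M borel (\<lambda>\<omega>. Im (X \<omega>)) = distr (distr M (borel \<Otimes>\<^sub>M borel) (\<lambda>\<omega>. (Re (X \<omega>), Im (X \<omega>)))) borel snd"
    by (subst distr_distr) (simp_all add: comp_def)
  also have "\<dots> = distr (centred_normal (v / 2) \<Otimes>\<^sub>M centred_normal (v / 2)) (centred_normal (v / 2)) snd"
    unfolding joint by (rule distr_cong) simp_all
  \<comment> \<open>Both factors coincide, so swapping them reduces the second marginal to the
    first.\<close>
  also have "\<dots> = distr (centred_normal (v / 2) \<Otimes>\<^sub>M centred_normal (v / 2)) (centred_normal (v / 2)) fst"
    by (subst C2.distr_pair_swap) (simp add: distr_distr comp_def split_beta')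
  also have "\<dots> = centred_normal (v / 2)" by (rule C.distr_pair_fst)
  finally have im: "distr M borel (\<lambda>\<omega>. Im (X \<omega>)) = centred_normal (v / 2)" .
  have "indep_var borel (\<lambda>\<omega>. Re (X \<omega>)) borel (\<lambda>\<omega>. Im (X \<omega>))"
    unfolding indep_var_distribution_eq by (simp add: re im joint)
  then have "indep_vars (\<lambda>_. borel) (\<lambda>r \<omega>. re_im r (X \<omega>)) UNIV"
    unfolding indep_var_def
    by (rule indep_vars_cong[THEN iffD1, rotated -1]) (auto simp: re_im_def split: bool.split)
  moreover have "distr M borel (\<lambda>\<omega>. re_im r (X \<omega>)) = centred_normal (v / 2)" for r
    by (cases r) (simp_all add: re_im_def re im)
  ultimately show ?thesis by (simp add: indep_normal_def)
qed

lemma indep_cn_parts: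
  assumes ind: "indep_vars (\<lambda>_. borel) X I" and law: "\<And>i. i \<in> I \<Longrightarrow> has_cn_law (X i) v"
  shows "indep_normal (\<lambda>(i, r) \<omega>. re_im r (X i \<omega>)) (I \<times> UNIV) (v / 2)"
proof -
  have "indep_vars (\<lambda>i. \<Pi>\<^sub>M r\<in>UNIV. borel) (\<lambda>i \<omega>. \<lambda>r\<in>UNIV. re_im r (X i \<omega>)) I"
    by (rule indep_vars_compose2[OF ind, of "\<lambda>_ z. \<lambda>r\<in>UNIV. re_im r z"]) measurable
  from this have "indep_vars (\<lambda>(i, r). borel) (\<lambda>(i, r) \<omega>. re_im r (X i \<omega>)) (I \<times> UNIV)"
    by (rule indep_vars_Sigma) (use has_cn_law_parts[OF law] in \<open>auto simp: indep_normal_def\<close>)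
  then show ?thesis using has_cn_law_parts[OF law] by (auto simp: indep_normal_def split_beta')
qed

end

section \<open>Inverse moments of Gaussian vectors\<close>

text \<open>Covers r = 0 in the integral of \<open>exp (- (s * r))\<close> over the half-line, where
  the integrand is constantly 1.\<close>

lemma emeasure_lborel_atLeast: "emeasure lborel {a::real..} = \<infinity>"
proof (rule ccontr)
  assume "emeasure lborel {a..} \<noteq> \<infinity>"
  then obtain r where r: "0 \<le> r" "emeasure lborel {a..} = ennreal r"
    by (cases "emeasure lborel {a..}") auto
  have "ennreal (r + 1) = emeasure lborel {a..a + (r + 1)}" using r by simp
  also have "\<dots> \<le> emeasure lborel {a..}" by (rule emeasure_mono) auto
  finally show False using r by simp
qed

lemma nn_integral_exp_scale:
  assumes "0 < r"
  shows "(\<integral>\<^sup>+s. ennreal (exp (- (s * r))) * indicator {0..} s \<partial>lborel) = ennreal (1 / r)"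
proof -
  have "(\<integral>\<^sup>+s. ennreal (exp (- (s * r))) * indicator {0..} s \<partial>lborel) =
      ennreal (0 - (- (exp (- (0 * r)) / r)))"
  proof (rule nn_integral_FTC_atLeast)
    show "((\<lambda>s. - (exp (- (s * r)) / r)) \<longlongrightarrow> 0) at_top" using assms by real_asymp
  qed (use assms in \<open>auto intro!: derivative_eq_intros\<close>)
  then show ?thesis by simp
qed

text \<open>The primitive has exponent \<open>m - 1\<close>, hence the factor \<open>m - 1\<close>
  in the value; for m = 1 it would be a logarithm and the integral would diverge.\<close>

lemma nn_integral_inverse_power:
  assumes "0 < c" "2 \<le> m"
  shows "(\<integral>\<^sup>+s. ennreal (1 / (1 + c * s) ^ m) * indicator {0..} s \<partial>lborel) = ennreal (1 / (c * (real m - 1)))"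
proof -
  obtain k where m: "m = Suc (Suc k)" using assms(2) by (metis Suc_le_D Suc_le_mono numeral_2_eq_2)
  let ?F = "\<lambda>s. - (inverse (1 + c * s) ^ Suc k / (c * real (Suc k)))"
  have "(\<integral>\<^sup>+s. ennreal (1 / (1 + c * s) ^ m) * indicator {0..} s \<partial>lborel) = ennreal (0 - ?F 0)"
  proof (rule nn_integral_FTC_atLeast)
    have "filterlim (\<lambda>s. 1 + c * s) at_infinity at_top"
      by (rule filterlim_at_top_imp_at_infinity) (use assms in real_asymp)
    from tendsto_power[OF filterlim_compose[OF tendsto_inverse_0 this], of "Suc k"]
    have "((\<lambda>s. inverse (1 + c * s) ^ Suc k) \<longlongrightarrow> 0) at_top" by simp
    from tendsto_minus[OF tendsto_divide_zero[OF this]] show "(?F \<longlongrightarrow> 0) at_top" by simp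
    fix s :: real assume s: "0 \<le> s"
    then have pos: "1 + c * s > 0" using assms by (simp add: add_pos_nonneg)
    have "((\<lambda>s. inverse (1 + c * s)) has_real_derivative - (inverse (1 + c * s) * c * inverse (1 + c * s))) (at s)"
      using pos by (auto intro!: derivative_eq_intros)
    from DERIV_minus[OF DERIV_cdivide[OF DERIV_power[OF this, of "Suc k"]], of "c * real (Suc k)"]
    have "(?F has_real_derivative
        - (real (Suc k) * (- (inverse (1 + c * s) * c * inverse (1 + c * s)) * inverse (1 + c * s) ^ k)
          / (c * real (Suc k)))) (at s)" by simp
    also have "- (real (Suc k) * (- (inverse (1 + c * s) * c * inverse (1 + c * s)) * inverse (1 + c * s) ^ k)
          / (c * real (Suc k))) = inverse (1 + c * s) ^ m"
      using assms(1) by (simp add: m del: of_nat_Suc)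
    also have "\<dots> = 1 / (1 + c * s) ^ m" by (simp add: inverse_eq_divide power_one_over)
    finally show "(?F has_real_derivative 1 / (1 + c * s) ^ m) (at s)" .
    show "0 \<le> 1 / (1 + c * s) ^ m" using pos by simp
  qed simp
  then show ?thesis by (simp add: m add.commute)
qed

context prob_space begin

text \<open>Tonelli on the product of the two laws. The inner integral runs over a second copy of
  the sample space with \<open>X\<close> frozen, which is how conditioning is expressed.\<close>

lemma indep_var_nn_integral:
  assumes ind: "indep_var S X T Y" and [measurable]: "f \<in> borel_measurable (S \<Otimes>\<^sub>M T)"
  shows "(\<integral>\<^sup>+\<omega>. f (X \<omega>, Y \<omega>) \<partial>M) = (\<integral>\<^sup>+\<omega>. \<integral>\<^sup>+\<omega>'. f (X \<omega>, Y \<omega>') \<partial>M \<partial>M)"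
proof -
  have [measurable]: "random_variable S X" "random_variable T Y"
    and eq: "distr M S X \<Otimes>\<^sub>M distr M T Y = distr M (S \<Otimes>\<^sub>M T) (\<lambda>x. (X x, Y x))"
    using ind by (auto simp: indep_var_distribution_eq)
  interpret Y: prob_space "distr M T Y" by (rule prob_space_distr) simp
  have "(\<integral>\<^sup>+\<omega>. f (X \<omega>, Y \<omega>) \<partial>M) = (\<integral>\<^sup>+z. f z \<partial>(distr M S X \<Otimes>\<^sub>M distr M T Y))"
    unfolding eq by (subst nn_integral_distr) simp_all
  also have "\<dots> = (\<integral>\<^sup>+x. \<integral>\<^sup>+y. f (x, y) \<partial>distr M T Y \<partial>distr M S X)"
    by (subst Y.nn_integral_fst[symmetric]) simp_all
  also have "\<dots> = (\<integral>\<^sup>+\<omega>. \<integral>\<^sup>+\<omega>'. f (X \<omega>, Y \<omega>') \<partial>M \<partial>M)"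
    by (subst nn_integral_distr) (simp_all add: nn_integral_distr cong: nn_integral_cong)
  finally show ?thesis .
qed

lemma nn_integral_square_linear_combination:
  assumes X: "indep_normal X I v" and "finite I" "0 \<le> v"
  shows "(\<integral>\<^sup>+\<omega>. ennreal ((\<Sum>i\<in>I. d i * X i \<omega>)\<^sup>2) \<partial>M) = ennreal (v * (\<Sum>i\<in>I. (d i)\<^sup>2))"
proof -
  have [measurable]: "random_variable borel (\<lambda>\<omega>. \<Sum>i\<in>I. d i * X i \<omega>)"
    using indep_normal_rv[OF X] by measurable
  have "(\<integral>\<^sup>+\<omega>. ennreal ((\<Sum>i\<in>I. d i * X i \<omega>)\<^sup>2) \<partial>M) =
      (\<integral>\<^sup>+x. ennreal (x\<^sup>2) \<partial>distr M borel (\<lambda>\<omega>. \<Sum>i\<in>I. d i * X i \<omega>))"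
    by (subst nn_integral_distr) simp_all
  also have "distr M borel (\<lambda>\<omega>. \<Sum>i\<in>I. d i * X i \<omega>) = centred_normal (\<Sum>i\<in>I. (d i)\<^sup>2 * v)"
    by (rule distr_normal_linear_combination) (use X assms(2,3) in \<open>auto simp: indep_normal_def\<close>)
  finally show ?thesis
    using assms(3) by (simp add: nn_integral_square_centred_normal sum_nonneg sum_distrib_left mult.commute)
qed

lemma nn_integral_sum_squares:
  assumes X: "indep_normal X I v" and "finite I" "0 \<le> v"
  shows "(\<integral>\<^sup>+\<omega>. ennreal (\<Sum>i\<in>I. (X i \<omega>)\<^sup>2) \<partial>M) = ennreal (real (card I) * v)"
proof -
  have rv: "\<And>i. i \<in> I \<Longrightarrow> random_variable borel (X i)" using indep_normal_rv[OF X] .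
  have "(\<integral>\<^sup>+\<omega>. ennreal (\<Sum>i\<in>I. (X i \<omega>)\<^sup>2) \<partial>M) = (\<Sum>i\<in>I. \<integral>\<^sup>+\<omega>. ennreal ((X i \<omega>)\<^sup>2) \<partial>M)"
    using rv by (subst nn_integral_sum[symmetric]) simp_all
  also have "\<dots> = (\<Sum>i\<in>I. ennreal v)"
  proof (rule sum.cong[OF refl])
    fix i assume i: "i \<in> I"
    then have "(\<integral>\<^sup>+\<omega>. ennreal ((X i \<omega>)\<^sup>2) \<partial>M) = (\<integral>\<^sup>+x. ennreal (x\<^sup>2) \<partial>distr M borel (X i))"
      using rv by (subst nn_integral_distr) simp_all
    then show "(\<integral>\<^sup>+\<omega>. ennreal ((X i \<omega>)\<^sup>2) \<partial>M) = ennreal v"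
      using X i assms by (simp add: indep_normal_def nn_integral_square_centred_normal)
  qed
  finally show ?thesis using assms by (simp add: ennreal_mult' ennreal_of_nat_eq_real_of_nat)
qed

text \<open>Integrates the Laplace transform of the chi-square law, since
  \<open>1 / r = \<integral> exp (- s r) ds\<close> over \<open>s \<ge> 0\<close>.\<close>

lemma inverse_sum_squares:
  assumes X: "indep_normal X I v" and fin: "finite I" and v: "0 < v"
    and card: "card I = 2 * m" and m: "2 \<le> m"
  shows "(\<integral>\<^sup>+\<omega>. ennreal (1 / (\<Sum>i\<in>I. (X i \<omega>)\<^sup>2)) \<partial>M) \<le> ennreal (1 / (2 * v * (real m - 1)))" (is ?le)
    and "AE \<omega> in M. 0 < (\<Sum>i\<in>I. (X i \<omega>)\<^sup>2)" (is ?pos)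
proof -
  have rv [measurable]: "\<And>i. i \<in> I \<Longrightarrow> random_variable borel (X i)" using indep_normal_rv[OF X] .
  define R where "R \<omega> = (\<Sum>i\<in>I. (X i \<omega>)\<^sup>2)" for \<omega>
  have [measurable]: "random_variable borel R" unfolding R_def by measurable
  have R: "0 \<le> R \<omega>" for \<omega> by (simp add: R_def sum_nonneg)
  define E where "E \<omega> = (\<integral>\<^sup>+s. ennreal (exp (- (s * R \<omega>))) * indicator {0..} s \<partial>lborel)" for \<omega>
  have [measurable]: "E \<in> borel_measurable M" unfolding E_def by measurable
  have laplace: "(\<integral>\<^sup>+\<omega>. ennreal (exp (- (s * R \<omega>))) \<partial>M) = ennreal (1 / (1 + 2 * v * s) ^ m)"
    if s: "0 \<le> s" for s
  proof -
    have "(\<integral>\<^sup>+\<omega>. ennreal (exp (- (s * R \<omega>))) \<partial>M) =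
        (\<integral>\<^sup>+\<omega>. (\<Prod>i\<in>I. ennreal (exp (- (s * (X i \<omega>)\<^sup>2)))) \<partial>M)"
      using fin by (simp add: R_def sum_distrib_left exp_sum prod_ennreal flip: sum_negf)
    also have "\<dots> = (\<Prod>i\<in>I. \<integral>\<^sup>+\<omega>. ennreal (exp (- (s * (X i \<omega>)\<^sup>2))) \<partial>M)"
    proof (rule indep_vars_nn_integral[OF fin])
      have "indep_vars (\<lambda>_. borel) X I" using X by (simp add: indep_normal_def)
      from indep_vars_compose2[OF this, of "\<lambda>_ x. ennreal (exp (- (s * x\<^sup>2)))" "\<lambda>_. borel"]
      show "indep_vars (\<lambda>_. borel) (\<lambda>i \<omega>. ennreal (exp (- (s * (X i \<omega>)\<^sup>2)))) I" by simp
    qed simp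
    also have "\<dots> = (\<Prod>i\<in>I. ennreal (1 / sqrt (1 + 2 * s * v)))"
    proof (rule prod.cong[OF refl])
      fix i assume i: "i \<in> I"
      then have "(\<integral>\<^sup>+\<omega>. ennreal (exp (- (s * (X i \<omega>)\<^sup>2))) \<partial>M) =
          (\<integral>\<^sup>+x. ennreal (exp (- (s * x\<^sup>2))) \<partial>distr M borel (X i))"
        by (subst nn_integral_distr) simp_all
      then show "(\<integral>\<^sup>+\<omega>. ennreal (exp (- (s * (X i \<omega>)\<^sup>2))) \<partial>M) = ennreal (1 / sqrt (1 + 2 * s * v))"
        using X i v s by (simp add: indep_normal_def nn_integral_exp_square_centred_normal)
    qed
    also have "\<dots> = ennreal (1 / (1 + 2 * v * s) ^ m)"
    \<comment> \<open>The even number \<open>2 * m\<close> of real coordinates removes the square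
      roots of the single Laplace transforms.\<close>
    proof -
      have pos: "0 \<le> 1 + 2 * s * v" using s v by simp
      have "(1 / sqrt (1 + 2 * s * v)) ^ (2 * m) = ((1 / sqrt (1 + 2 * s * v))\<^sup>2) ^ m"
        by (rule power_mult)
      also have "\<dots> = 1 / (1 + 2 * v * s) ^ m"
        using pos by (simp add: power_divide mult_ac)
      finally show ?thesis using pos by (simp add: card ennreal_power)
    qed
    finally show ?thesis .
  qed
  interpret pair_sigma_finite M lborel ..
  have "(\<integral>\<^sup>+\<omega>. E \<omega> \<partial>M) = (\<integral>\<^sup>+s. \<integral>\<^sup>+\<omega>. ennreal (exp (- (s * R \<omega>))) * indicator {0..} s \<partial>M \<partial>lborel)"
    unfolding E_def by (rule Fubini'[symmetric]) measurable
  also have "\<dots> = (\<integral>\<^sup>+s. ennreal (1 / (1 + 2 * v * s) ^ m) * indicator {0..} s \<partial>lborel)"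
    by (intro nn_integral_cong) (auto simp: laplace nn_integral_multc indicator_def)
  also have "\<dots> = ennreal (1 / (2 * v * (real m - 1)))"
    using v m by (intro nn_integral_inverse_power) auto
  finally have intE: "(\<integral>\<^sup>+\<omega>. E \<omega> \<partial>M) = ennreal (1 / (2 * v * (real m - 1)))" .
  have E_pos: "E \<omega> = ennreal (1 / R \<omega>)" if "0 < R \<omega>" for \<omega>
    unfolding E_def using that by (rule nn_integral_exp_scale)
  \<comment> \<open>Where \<open>R\<close> is 0, \<open>E\<close> is infinite while
    \<open>1 / R\<close> is 0 by convention. The inequality between them survives, and the finite
    integral of \<open>E\<close> then excludes this event almost everywhere.\<close>
  have E_0: "E \<omega> = \<infinity>" if "R \<omega> = 0" for \<omega>
    unfolding E_def that by (simp add: emeasure_lborel_atLeast)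
  have "ennreal (1 / R \<omega>) \<le> E \<omega>" for \<omega>
    using E_pos[of \<omega>] R[of \<omega>] by (cases "R \<omega> = 0") auto
  then show ?le
    unfolding intE[symmetric] R_def[symmetric] by (intro nn_integral_mono) simp
  have "AE \<omega> in M. E \<omega> \<noteq> \<infinity>"
    by (rule nn_integral_PInf_AE) (simp_all add: intE)
  then show ?pos
    unfolding R_def[symmetric] using E_0 R by (auto simp: less_le elim!: eventually_mono)
qed

text \<open>Stated on real coordinates, with half the variance each, so that m complex entries are
  one independent family of \<open>2 * m\<close> real normals.\<close>

definition cn_family :: "(nat \<Rightarrow> 'a \<Rightarrow> complex) \<Rightarrow> nat \<Rightarrow> real \<Rightarrow> bool" where
  "cn_family A m v \<longleftrightarrow> indep_normal (\<lambda>(i, r) \<omega>. re_im r (A i \<omega>)) ({..<m} \<times> UNIV) (v / 2)"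

lemma sum_re_im:
  "(\<Sum>j\<in>{..<m} \<times> UNIV. f j) = (\<Sum>i<m. f (i, True) + f (i, False))"
  using sum.cartesian_product[of "\<lambda>i r. f (i, r)" UNIV "{..<m}"]
  by (simp add: UNIV_bool add.commute)

lemma cmod_sq_parts: "(cmod z)\<^sup>2 = (re_im True z)\<^sup>2 + (re_im False z)\<^sup>2"
  by (simp add: re_im_def cmod_power2)

lemma sum_cmod_sq_parts:
  "(\<Sum>i<m. (cmod (A i \<omega>))\<^sup>2) =
     (\<Sum>j\<in>{..<m} \<times> UNIV. ((\<lambda>(i, r) \<omega>. re_im r (A i \<omega>)) j \<omega>)\<^sup>2)"
  by (simp add: sum_re_im cmod_sq_parts)

lemma cn_family_rv:
  assumes A: "cn_family A m v" and i: "i < m"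
  shows "random_variable borel (A i)"
proof -
  have [measurable]: "random_variable borel (\<lambda>\<omega>. re_im r (A i \<omega>))" for r
    using indep_normal_rv[OF A[unfolded cn_family_def], of "(i, r)"] i by simp
  have "A i = (\<lambda>\<omega>. complex_of_real (re_im True (A i \<omega>)) + \<i> * complex_of_real (re_im False (A i \<omega>)))"
    by (auto simp: re_im_def complex_eq)
  then show ?thesis by (rule ssubst) measurable
qed

lemma cn_family_nn_integral_sq:
  assumes "cn_family A m v" "0 \<le> v"
  shows "(\<integral>\<^sup>+\<omega>. ennreal (\<Sum>i<m. (cmod (A i \<omega>))\<^sup>2) \<partial>M) = ennreal (real m * v)"
  unfolding sum_cmod_sq_parts
  by (subst nn_integral_sum_squares[OF assms(1)[unfolded cn_family_def]])
    (use assms in \<open>simp_all add: card_cartesian_product card_UNIV_bool\<close>)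

lemma cn_family_inverse_sq:
  assumes A: "cn_family A m v" and v: "0 < v" and m: "2 \<le> m"
  shows "(\<integral>\<^sup>+\<omega>. ennreal (1 / (\<Sum>i<m. (cmod (A i \<omega>))\<^sup>2)) \<partial>M) \<le> ennreal (1 / ((real m - 1) * v))"
    and "AE \<omega> in M. 0 < (\<Sum>i<m. (cmod (A i \<omega>))\<^sup>2)"
  using inverse_sum_squares[OF A[unfolded cn_family_def], of m] v m
  unfolding sum_cmod_sq_parts by (simp_all add: card_cartesian_product card_UNIV_bool mult_ac)

text \<open>Real and imaginary part of the sum are each a real combination of the
  \<open>2 * m\<close> coordinates with the same sum of squared coefficients, so each contributes
  half of the result.\<close>

lemma cn_family_linear_combination_sq:
  assumes B: "cn_family B m w" and w: "0 \<le> w"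
  shows "(\<integral>\<^sup>+\<omega>. ennreal ((cmod (\<Sum>i<m. B i \<omega> * c i))\<^sup>2) \<partial>M) = ennreal (w * (\<Sum>i<m. (cmod (c i))\<^sup>2))"
proof -
  let ?I = "{..<m} \<times> (UNIV :: bool set)"
  let ?X = "\<lambda>(i, r) \<omega>. re_im r (B i \<omega>)"
  \<comment> \<open>The coefficients come from Re(z c) = Re z Re c - Im z Im c and Im(z c) = Re z Im
    c + Im z Re c.\<close>
  define d where "d = (\<lambda>(i, r). if r then Re (c i) else - Im (c i))"
  define d' where "d' = (\<lambda>(i, r). if r then Im (c i) else Re (c i))"
  have X: "indep_normal ?X ?I (w / 2)" using B by (simp add: cn_family_def)
  have rv [measurable]: "random_variable borel (?X j)" if "j \<in> ?I" for j
    using indep_normal_rv[OF X that] .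
  have Re: "Re (\<Sum>i<m. B i \<omega> * c i) = (\<Sum>j\<in>?I. d j * ?X j \<omega>)" for \<omega>
    by (simp add: sum_re_im d_def re_im_def mult.commute)
  have Im: "Im (\<Sum>i<m. B i \<omega> * c i) = (\<Sum>j\<in>?I. d' j * ?X j \<omega>)" for \<omega>
    by (simp add: sum_re_im d'_def re_im_def mult.commute)
  have d: "(\<Sum>j\<in>?I. (d j)\<^sup>2) = (\<Sum>i<m. (cmod (c i))\<^sup>2)"
    by (simp add: sum_re_im d_def cmod_power2)
  have d': "(\<Sum>j\<in>?I. (d' j)\<^sup>2) = (\<Sum>i<m. (cmod (c i))\<^sup>2)"
    by (simp add: sum_re_im d'_def cmod_power2 add.commute)
  have "(\<integral>\<^sup>+\<omega>. ennreal ((cmod (\<Sum>i<m. B i \<omega> * c i))\<^sup>2) \<partial>M) =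
      (\<integral>\<^sup>+\<omega>. ennreal ((\<Sum>j\<in>?I. d j * ?X j \<omega>)\<^sup>2) + ennreal ((\<Sum>j\<in>?I. d' j * ?X j \<omega>)\<^sup>2) \<partial>M)"
    unfolding cmod_power2 Re Im by simp
  also have "\<dots> = (\<integral>\<^sup>+\<omega>. ennreal ((\<Sum>j\<in>?I. d j * ?X j \<omega>)\<^sup>2) \<partial>M) +
      (\<integral>\<^sup>+\<omega>. ennreal ((\<Sum>j\<in>?I. d' j * ?X j \<omega>)\<^sup>2) \<partial>M)"
    by (rule nn_integral_add) measurable
  also have "\<dots> = ennreal (w / 2 * (\<Sum>i<m. (cmod (c i))\<^sup>2)) + ennreal (w / 2 * (\<Sum>i<m. (cmod (c i))\<^sup>2))"
    using w by (simp add: nn_integral_square_linear_combination[OF X] d d')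
  also have "\<dots> = ennreal (w * (\<Sum>i<m. (cmod (c i))\<^sup>2))"
    using w by (subst ennreal_plus[symmetric]) (simp_all add: sum_nonneg)
  finally show ?thesis .
qed

text \<open>With \<open>A\<close> frozen the numerator has mean \<open>w\<close> times the squared
  norm of \<open>A\<close>; dividing by the fourth power of the norm leaves \<open>w\<close> over
  its square. The mean of that reciprocal stays unevaluated, as a common factor for all
  interferers.\<close>

lemma cn_family_projection:
  assumes ind: "indep_var (\<Pi>\<^sub>M i\<in>{..<m}. borel) (\<lambda>\<omega>. \<lambda>i\<in>{..<m}. A i \<omega>)
      (\<Pi>\<^sub>M i\<in>{..<m}. borel) (\<lambda>\<omega>. \<lambda>i\<in>{..<m}. B i \<omega>)"
    and B: "cn_family B m w" "0 \<le> w"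
  shows "(\<integral>\<^sup>+\<omega>. ennreal ((cmod (\<Sum>i<m. B i \<omega> * cnj (A i \<omega>)))\<^sup>2 / (\<Sum>i<m. (cmod (A i \<omega>))\<^sup>2)\<^sup>2) \<partial>M) =
    ennreal w * (\<integral>\<^sup>+\<omega>. ennreal (1 / (\<Sum>i<m. (cmod (A i \<omega>))\<^sup>2)) \<partial>M)"
proof -
  define S where "S = (\<Pi>\<^sub>M i\<in>{..<m}. (borel :: complex measure))"
  define f where "f z = ennreal ((cmod (\<Sum>i<m. snd z i * cnj (fst z i)))\<^sup>2 / (\<Sum>i<m. (cmod (fst z i))\<^sup>2)\<^sup>2)"
    for z :: "(nat \<Rightarrow> complex) \<times> (nat \<Rightarrow> complex)"
  have x: "(\<lambda>x. x i) \<in> borel_measurable S" if "i \<in> {..<m}" for i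
    unfolding S_def by (rule measurable_component_singleton) (use that in simp)
  note fst = measurable_compose[OF measurable_fst[where ?M2.0=S] x]
    and snd = measurable_compose[OF measurable_snd[where ?M1.0=S] x]
  have [measurable]: "cnj \<in> borel_measurable borel"
    by (intro borel_measurable_continuous_onI continuous_intros)
  have f: "f \<in> borel_measurable (S \<Otimes>\<^sub>M S)"
    unfolding f_def
    by (intro measurable_compose[OF _ measurable_ennreal] borel_measurable_divide borel_measurable_power
        measurable_compose[OF _ borel_measurable_norm] borel_measurable_sum borel_measurable_times snd fst
        measurable_compose[OF fst, of _ cnj])
      simp_all
  have [measurable]: "random_variable borel (A i)" if "i \<in> {..<m}" for i
  proof -
    have "random_variable borel (\<lambda>\<omega>. (\<lambda>i\<in>{..<m}. A i \<omega>) i)"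
      by (rule measurable_compose[OF indep_var_rv1[OF ind]]) (use that in measurable)
    then show ?thesis using that by simp
  qed
  have Bm [measurable]: "random_variable borel (B i)" if "i \<in> {..<m}" for i
    using cn_family_rv[OF B(1)] that by simp
  have "(\<integral>\<^sup>+\<omega>. ennreal ((cmod (\<Sum>i<m. B i \<omega> * cnj (A i \<omega>)))\<^sup>2 / (\<Sum>i<m. (cmod (A i \<omega>))\<^sup>2)\<^sup>2) \<partial>M) =
      (\<integral>\<^sup>+\<omega>. f (\<lambda>i\<in>{..<m}. A i \<omega>, \<lambda>i\<in>{..<m}. B i \<omega>) \<partial>M)"
    by (simp add: f_def)
  also have "\<dots> = (\<integral>\<^sup>+\<omega>. \<integral>\<^sup>+\<omega>'. f (\<lambda>i\<in>{..<m}. A i \<omega>, \<lambda>i\<in>{..<m}. B i \<omega>') \<partial>M \<partial>M)"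
    by (rule indep_var_nn_integral[OF ind]) (use f in \<open>simp add: S_def\<close>)
  also have "\<dots> = (\<integral>\<^sup>+\<omega>. ennreal w * ennreal (1 / (\<Sum>i<m. (cmod (A i \<omega>))\<^sup>2)) \<partial>M)"
  proof (rule nn_integral_cong)
    fix \<omega>
    let ?R = "\<Sum>i<m. (cmod (A i \<omega>))\<^sup>2"
    have "(\<integral>\<^sup>+\<omega>'. f (\<lambda>i\<in>{..<m}. A i \<omega>, \<lambda>i\<in>{..<m}. B i \<omega>') \<partial>M) =
        (\<integral>\<^sup>+\<omega>'. ennreal (1 / ?R\<^sup>2) * ennreal ((cmod (\<Sum>i<m. B i \<omega>' * cnj (A i \<omega>)))\<^sup>2) \<partial>M)"
      by (simp add: f_def ennreal_mult'[symmetric])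
    also have "\<dots> = ennreal (1 / ?R\<^sup>2) * ennreal (w * (\<Sum>i<m. (cmod (cnj (A i \<omega>)))\<^sup>2))"
      by (subst nn_integral_cmult) (simp_all only: cn_family_linear_combination_sq[OF B], measurable)
    also have "\<dots> = ennreal (1 / ?R\<^sup>2 * (w * ?R))"
      by (simp add: ennreal_mult'[symmetric])
    \<comment> \<open>This includes \<open>?R = 0\<close>, where both sides are 0.\<close>
    also have "1 / ?R\<^sup>2 * (w * ?R) = w * (1 / ?R)" by (simp add: power2_eq_square)
    also have "ennreal (w * (1 / ?R)) = ennreal w * ennreal (1 / ?R)"
      using B(2) by (rule ennreal_mult')
    finally show "(\<integral>\<^sup>+\<omega>'. f (\<lambda>i\<in>{..<m}. A i \<omega>, \<lambda>i\<in>{..<m}. B i \<omega>') \<partial>M) = ennreal w * ennreal (1 / ?R)" .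
  qed
  also have "\<dots> = ennreal w * (\<integral>\<^sup>+\<omega>. ennreal (1 / (\<Sum>i<m. (cmod (A i \<omega>))\<^sup>2)) \<partial>M)"
    by (rule nn_integral_cmult) measurable
  finally show ?thesis .
qed

end

section \<open>The prediction normal equations\<close>

text \<open>The quadratic form of \<Delta>: the variance of the combination of \<open>p + 1\<close>
  consecutive channel samples with weights \<open>x\<close>, for \<beta> = 1.\<close>

definition corr_form :: "real \<Rightarrow> nat \<Rightarrow> (nat \<Rightarrow> real) \<Rightarrow> real" where
  "corr_form a p x = (\<Sum>i\<le>p. \<Sum>j\<le>p. x i * x j * a ^ nat \<bar>int i - int j\<bar>)"

lemma corr_form_0 [simp]: "corr_form a 0 x = (x 0)\<^sup>2"
  by (simp add: corr_form_def power2_eq_square)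

text \<open>Changing coordinate 0 involves only row 0 of \<Delta>, which is \<delta>, and its
  diagonal entry 1. The identity serves both the elimination of a sample and the bound on the
  predictor.\<close>

lemma corr_form_shift:
  "corr_form a p (x(0 := x 0 + c)) =
     corr_form a p x + 2 * c * (\<Sum>j\<le>p. x j * a ^ j) + c\<^sup>2"
proof -
  let ?d = "\<lambda>i::nat. if i = 0 then c else 0"
  have 1: "(\<Sum>i\<le>p. \<Sum>j\<le>p. ?d i * f i j) = c * (\<Sum>j\<le>p. f 0 j)" for f
  proof -
    have "(\<Sum>j\<le>p. ?d i * f i j) = (if i = 0 then c * (\<Sum>j\<le>p. f 0 j) else 0)" for i
      by (simp add: sum_distrib_left)
    then show ?thesis by simp
  qed
  have "corr_form a p (x(0 := x 0 + c)) =
      (\<Sum>i\<le>p. \<Sum>j\<le>p. (x i + ?d i) * (x j + ?d j) * a ^ nat \<bar>int i - int j\<bar>)"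
    unfolding corr_form_def by (intro sum.cong refl) auto
  also have "\<dots> = corr_form a p x
      + (\<Sum>i\<le>p. \<Sum>j\<le>p. ?d i * (x j * a ^ nat \<bar>int i - int j\<bar>))
      + (\<Sum>i\<le>p. \<Sum>j\<le>p. ?d j * (x i * a ^ nat \<bar>int i - int j\<bar>))
      + (\<Sum>i\<le>p. \<Sum>j\<le>p. ?d i * (?d j * a ^ nat \<bar>int i - int j\<bar>))"
    unfolding corr_form_def sum.distrib[symmetric]
    by (intro sum.cong refl) (simp add: algebra_simps)
  also have "(\<Sum>i\<le>p. \<Sum>j\<le>p. ?d j * (x i * a ^ nat \<bar>int i - int j\<bar>)) =
      (\<Sum>i\<le>p. \<Sum>j\<le>p. ?d i * (x j * a ^ nat \<bar>int i - int j\<bar>))"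
    by (subst sum.swap) (simp add: abs_minus_commute)
  also have "(\<Sum>i\<le>p. \<Sum>j\<le>p. ?d i * (x j * a ^ nat \<bar>int i - int j\<bar>)) = c * (\<Sum>j\<le>p. x j * a ^ j)"
    by (subst 1) simp
  also have "(\<Sum>i\<le>p. \<Sum>j\<le>p. ?d i * (?d j * a ^ nat \<bar>int i - int j\<bar>)) = c\<^sup>2"
    by (subst 1) (simp add: if_distrib[of "\<lambda>z. z * _"] power2_eq_square cong: if_cong)
  finally show ?thesis by linarith
qed

text \<open>Eliminates the newest sample through \<open>g[n] = a g[n - 1] + e[n]\<close>.\<close>

lemma corr_form_Suc:
  "corr_form a (Suc p) x =
     (1 - a\<^sup>2) * (x 0)\<^sup>2 + corr_form a p ((x \<circ> Suc)(0 := x 1 + a * x 0))"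
proof -
  have "corr_form a (Suc p) x =
      (\<Sum>j\<le>Suc p. x 0 * x j * a ^ j)
      + (\<Sum>i\<le>p. \<Sum>j\<le>Suc p. x (Suc i) * x j * a ^ nat \<bar>int (Suc i) - int j\<bar>)"
    unfolding corr_form_def by (subst sum.atMost_Suc_shift) simp
  also have "(\<Sum>j\<le>Suc p. x 0 * x j * a ^ j) =
      (x 0)\<^sup>2 + a * x 0 * (\<Sum>j\<le>p. x (Suc j) * a ^ j)"
    by (subst sum.atMost_Suc_shift) (simp add: power2_eq_square sum_distrib_left mult_ac)
  also have "(\<Sum>i\<le>p. \<Sum>j\<le>Suc p. x (Suc i) * x j * a ^ nat \<bar>int (Suc i) - int j\<bar>) =
      a * x 0 * (\<Sum>j\<le>p. x (Suc j) * a ^ j) + corr_form a p (x \<circ> Suc)"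
  proof -
    have "(\<Sum>j\<le>Suc p. x (Suc i) * x j * a ^ nat \<bar>int (Suc i) - int j\<bar>) =
        a * x 0 * (x (Suc i) * a ^ i) +
        (\<Sum>j\<le>p. x (Suc i) * x (Suc j) * a ^ nat \<bar>int i - int j\<bar>)" for i
      by (subst sum.atMost_Suc_shift) (simp add: nat_add_distrib mult_ac)
    then show ?thesis
      by (simp only: sum.distrib corr_form_def sum_distrib_left comp_apply)
  qed
  finally show ?thesis
    using corr_form_shift[of a p "x \<circ> Suc" "a * x 0"]
    by (simp add: algebra_simps power_mult_distrib)
qed

text \<open>Iterating the elimination writes the form as a sum of squares with weights
  \<open>1 - a^2\<close> and a final weight 1.\<close>

lemma corr_form_nonneg: "\<bar>a\<bar> \<le> 1 \<Longrightarrow> 0 \<le> corr_form a p x"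
proof (induction p arbitrary: x)
  case (Suc p)
  then have "a\<^sup>2 \<le> 1" by (simp add: abs_square_le_1)
  with Suc show ?case by (simp add: corr_form_Suc)
qed simp

text \<open>The weights \<open>r\<close> solve the normal equations \<open>r (\<beta> \<Delta> + c I) = \<delta>\<close>.\<close>

definition normal_eq :: "real \<Rightarrow> nat \<Rightarrow> real \<Rightarrow> real \<Rightarrow> (nat \<Rightarrow> real) \<Rightarrow> bool" where
  "normal_eq a p \<beta> c r \<longleftrightarrow>
     (\<forall>j\<le>p. \<beta> * (\<Sum>i\<le>p. r i * a ^ nat \<bar>int i - int j\<bar>) + c * r j = a ^ j)"

text \<open>Equation \<open>j\<close> is multiplied by \<open>r j\<close> and summed. This is the
  orthogonality principle: up to a common factor, the power of the predictor output equals its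
  correlation with the target.\<close>

lemma normal_eq_form:
  assumes "normal_eq a p \<beta> c r"
  shows "\<beta> * corr_form a p r + c * (\<Sum>j\<le>p. (r j)\<^sup>2) = (\<Sum>j\<le>p. r j * a ^ j)"
proof -
  have "(\<Sum>j\<le>p. r j * a ^ j) =
      (\<Sum>j\<le>p. r j * (\<beta> * (\<Sum>i\<le>p. r i * a ^ nat \<bar>int i - int j\<bar>) + c * r j))"
    using assms by (simp add: normal_eq_def)
  also have "\<dots> = \<beta> * (\<Sum>j\<le>p. \<Sum>i\<le>p. r i * r j * a ^ nat \<bar>int i - int j\<bar>) + c * (\<Sum>j\<le>p. (r j)\<^sup>2)"
    by (simp add: algebra_simps sum.distrib sum_distrib_left power2_eq_square)
  also have "(\<Sum>j\<le>p. \<Sum>i\<le>p. r i * r j * a ^ nat \<bar>int i - int j\<bar>) = corr_form a p r"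
    unfolding corr_form_def by (subst sum.swap) simp
  finally show ?thesis by simp
qed

text \<open>The upper bound says that estimation cannot extract more power than the channel has; it
  follows from a nonnegative error variance.\<close>

lemma normal_eq_bounds:
  assumes r: "normal_eq a p \<beta> c r" and "\<bar>a\<bar> \<le> 1" "0 < \<beta>" "0 \<le> c"
  shows "0 \<le> (\<Sum>j\<le>p. r j * a ^ j)" "\<beta> * (\<Sum>j\<le>p. r j * a ^ j) \<le> 1"
proof -
  let ?t = "\<Sum>j\<le>p. r j * a ^ j" and ?u = "\<lambda>j. \<beta> * r j"
  have c: "0 \<le> c * (\<Sum>j\<le>p. (r j)\<^sup>2)" using assms by (simp add: sum_nonneg)
  show "0 \<le> ?t"
    using normal_eq_form[OF r] corr_form_nonneg[of a p r] assms c by (metis add_nonneg_nonneg less_imp_le mult_nonneg_nonneg)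
  have u: "corr_form a p ?u = \<beta>\<^sup>2 * corr_form a p r"
    by (simp add: corr_form_def sum_distrib_left power2_eq_square mult_ac)
  have u': "(\<Sum>j\<le>p. ?u j * a ^ j) = \<beta> * ?t" by (simp add: sum_distrib_left mult_ac)
  \<comment> \<open>The vector \<beta> r minus the first unit vector gives the channel weights in
    the error of estimating the newest sample.\<close>
  have "0 \<le> corr_form a p (?u(0 := ?u 0 + - 1))" using assms by (intro corr_form_nonneg) auto
  also have "\<dots> = \<beta> * (\<beta> * corr_form a p r) - 2 * (\<beta> * ?t) + 1"
    unfolding corr_form_shift[of a p ?u "- 1"] u u' by (simp add: power2_eq_square)
  also have "\<dots> \<le> \<beta> * ?t - 2 * (\<beta> * ?t) + 1"
    using normal_eq_form[OF r] c assms by (intro add_right_mono diff_right_mono mult_left_mono) auto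
  finally show "\<beta> * ?t \<le> 1" by simp
qed

section \<open>Kronecker products with an identity and the predictor matrices\<close>

lemma sum_div_mod:
  fixes f :: "nat \<Rightarrow> nat \<Rightarrow> 'a :: comm_monoid_add"
  shows "(\<Sum>l<n * k. f (l div k) (l mod k)) = (\<Sum>a<n. \<Sum>b<k. f a b)"
proof -
  have "(\<Sum>l<n * k. f (l div k) (l mod k)) = (\<Sum>a<n. \<Sum>l\<in>{a * k..<a * k + k}. f (l div k) (l mod k))"
    by (rule sum.nat_group[symmetric])
  also have "\<dots> = (\<Sum>a<n. \<Sum>b<k. f a b)"
  proof (rule sum.cong[OF refl])
    fix a
    have "(\<Sum>l\<in>{a * k..<a * k + k}. f (l div k) (l mod k)) =
        (\<Sum>b<k. f ((b + a * k) div k) ((b + a * k) mod k))"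
      using sum.shift_bounds_nat_ivl[of "\<lambda>l. f (l div k) (l mod k)" 0 "a * k" k]
      by (simp add: add.commute lessThan_atLeast0)
    also have "\<dots> = (\<Sum>b<k. f a b)" by (rule sum.cong) auto
    finally show "(\<Sum>l\<in>{a * k..<a * k + k}. f (l div k) (l mod k)) = (\<Sum>b<k. f a b)" .
  qed
  finally show ?thesis .
qed

lemma mod_less_of_less_mult: "(i::nat) < n * m \<Longrightarrow> i mod m < m"
  by (cases m) auto

lemma kron_one_carrier [simp]:
  "dim_row (kron A (1\<^sub>m m)) = dim_row A * m" "dim_col (kron A (1\<^sub>m m)) = dim_col A * m"
  by (simp_all add: kron_def)

lemma kron_one_index:
  assumes "i < dim_row A * m" "j < dim_col A * m"
  shows "kron A (1\<^sub>m m) $$ (i, j) = (if i mod m = j mod m then A $$ (i div m, j div m) else 0)"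
  using assms by (simp add: kron_def mod_less_of_less_mult)

lemma index_mult_mat_sum:
  assumes "i < dim_row A" "j < dim_col B" "dim_col A = dim_row B"
  shows "(A * B) $$ (i, j) = (\<Sum>l<dim_row B. A $$ (i, l) * B $$ (l, j))"
  using assms by (simp add: scalar_prod_def lessThan_atLeast0)

text \<open>The mixed-product rule. A summation index is a pair of time and antenna; the identity
  factors force the antenna to agree at both ends, leaving the sum over times. Thus the predictor is
  computed with matrices of size \<open>p + 1\<close>.\<close>

lemma kron_one_mult:
  assumes "dim_col A = dim_row B"
  shows "kron A (1\<^sub>m m) * kron B (1\<^sub>m m) = kron (A * B) (1\<^sub>m m)"
proof (rule eq_matI)
  fix i j assume "i < dim_row (kron (A * B) (1\<^sub>m m))" "j < dim_col (kron (A * B) (1\<^sub>m m))"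
  then have i: "i < dim_row A * m" and j: "j < dim_col B * m" by simp_all
  have "(kron A (1\<^sub>m m) * kron B (1\<^sub>m m)) $$ (i, j) =
      (\<Sum>l<dim_row B * m. kron A (1\<^sub>m m) $$ (i, l) * kron B (1\<^sub>m m) $$ (l, j))"
    using i j assms by (subst index_mult_mat_sum) simp_all
  also have "\<dots> = (\<Sum>l<dim_row B * m. (\<lambda>a b. (if i mod m = b then A $$ (i div m, a) else 0) *
      (if b = j mod m then B $$ (a, j div m) else 0)) (l div m) (l mod m))"
    using i j assms by (intro sum.cong refl) (simp add: kron_one_index)
  also have "\<dots> = (\<Sum>a<dim_row B. \<Sum>b<m. (if i mod m = b then A $$ (i div m, a) else 0) *
      (if b = j mod m then B $$ (a, j div m) else 0))"
    by (rule sum_div_mod)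
  also have "\<dots> = (\<Sum>a<dim_row B. if i mod m = j mod m then A $$ (i div m, a) * B $$ (a, j div m) else 0)"
  proof (rule sum.cong[OF refl])
    fix a
    have "(\<Sum>b<m. (if i mod m = b then A $$ (i div m, a) else 0) * (if b = j mod m then B $$ (a, j div m) else 0)) =
        (\<Sum>b<m. if b = i mod m then (if i mod m = j mod m then A $$ (i div m, a) * B $$ (a, j div m) else 0) else 0)"
      by (rule sum.cong) auto
    then show "(\<Sum>b<m. (if i mod m = b then A $$ (i div m, a) else 0) * (if b = j mod m then B $$ (a, j div m) else 0)) =
        (if i mod m = j mod m then A $$ (i div m, a) * B $$ (a, j div m) else 0)"
      using mod_less_of_less_mult[OF i] by (simp add: sum.delta)
  qed
  also have "\<dots> = kron (A * B) (1\<^sub>m m) $$ (i, j)"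
    using i j assms less_mult_imp_div_less[OF i] less_mult_imp_div_less[OF j]
    by (simp add: kron_one_index index_mult_mat_sum del: index_mult_mat(1))
  finally show "(kron A (1\<^sub>m m) * kron B (1\<^sub>m m)) $$ (i, j) = kron (A * B) (1\<^sub>m m) $$ (i, j)" .
qed simp_all

lemma div_mod_eq_iff: "(i::nat) div m = j div m \<and> i mod m = j mod m \<longleftrightarrow> i = j"
  by (metis div_mult_mod_eq)

lemma kron_one_one: "kron (1\<^sub>m n) (1\<^sub>m m) = (1\<^sub>m (n * m) :: 'a :: semiring_1 mat)"
proof (rule eq_matI)
  fix i j assume "i < dim_row (1\<^sub>m (n * m) :: 'a mat)" "j < dim_col (1\<^sub>m (n * m) :: 'a mat)"
  then show "kron (1\<^sub>m n) (1\<^sub>m m) $$ (i, j) = (1\<^sub>m (n * m) :: 'a mat) $$ (i, j)"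
    using div_mod_eq_iff[of i m j] by (auto simp: kron_one_index less_mult_imp_div_less)
qed simp_all

text \<open>Uniqueness of inverses identifies the outcome of Gauss-Jordan elimination with an
  inverse found otherwise, here a Kronecker product.\<close>

lemma mat_inverse_eq_Some:
  fixes A :: "'a :: field mat"
  assumes A: "A \<in> carrier_mat n n" and B: "B \<in> carrier_mat n n"
    and AB: "A * B = 1\<^sub>m n" and BA: "B * A = 1\<^sub>m n"
  shows "mat_inverse A = Some B"
proof (cases "mat_inverse A")
  case None
  have "A \<in> Units (ring_mat TYPE('a) n ())"
    using assms by (auto simp: Units_def ring_mat_simps)
  with mat_inverse(1)[OF A None, of "()"] show ?thesis by blast
next
  case (Some C)
  then have C: "A * C = 1\<^sub>m n" "C \<in> carrier_mat n n" using mat_inverse(2)[OF A] by auto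
  have "C = (B * A) * C" using C BA by simp
  also have "\<dots> = B" using A B C by (subst assoc_mult_mat[of _ n n _ n _ n]) simp_all
  finally show ?thesis using Some by simp
qed

text \<open>A kernel vector \<open>v\<close> gives \<beta> times \<open>corr_form\<close> of
  \<open>v\<close> plus \<open>c\<close> times its squared norm equal to 0, so \<open>v\<close> is
  0. The noise term is essential: \<Delta> alone is singular for \<bar>a\<bar> = 1 and p \<ge>
  1.\<close>

lemma prediction_gram_inverse:
  fixes a c \<beta> :: real and p :: nat
  assumes "0 < \<beta>" "0 < c" "\<bar>a\<bar> \<le> 1"
  defines "S \<equiv> \<beta> \<cdot>\<^sub>m Delta_mat p a + c \<cdot>\<^sub>m 1\<^sub>m (p + 1)"
  obtains S' where "S' \<in> carrier_mat (p + 1) (p + 1)" "S * S' = 1\<^sub>m (p + 1)" "S' * S = 1\<^sub>m (p + 1)"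
proof -
  have S: "S \<in> carrier_mat (p + 1) (p + 1)" by (simp add: S_def Delta_mat_def)
  have S_ij: "S $$ (i, j) = \<beta> * a ^ nat \<bar>int i - int j\<bar> + (if i = j then c else 0)"
    if "i \<le> p" "j \<le> p" for i j
    using that by (simp add: S_def Delta_mat_def)
  have "det S \<noteq> 0"
  proof
    assume "det S = 0"
    then obtain v where v: "v \<in> carrier_vec (p + 1)" "v \<noteq> 0\<^sub>v (p + 1)" "S *\<^sub>v v = 0\<^sub>v (p + 1)"
      using det_0_iff_vec_prod_zero_field[OF S] by blast
    have row: "(\<Sum>j\<le>p. S $$ (i, j) * v $ j) = 0" if "i \<le> p" for i
    proof -
      have "(S *\<^sub>v v) $ i = 0" using v(3) that by simp
      moreover have "(S *\<^sub>v v) $ i = (\<Sum>j\<in>{0..<p + 1}. S $$ (i, j) * v $ j)"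
        using S v(1) that by (simp add: scalar_prod_def)
      ultimately show ?thesis by (simp add: atLeast0LessThan lessThan_Suc_atMost)
    qed
    have "0 = (\<Sum>i\<le>p. v $ i * (\<Sum>j\<le>p. S $$ (i, j) * v $ j))" by (simp add: row)
    also have "\<dots> = (\<Sum>i\<le>p. \<Sum>j\<le>p. \<beta> * (v $ i * v $ j * a ^ nat \<bar>int i - int j\<bar>) +
        (if i = j then c * (v $ i)\<^sup>2 else 0))"
      unfolding sum_distrib_left
      by (intro sum.cong refl) (auto simp: S_ij algebra_simps power2_eq_square)
    also have "\<dots> = \<beta> * corr_form a p (($) v) + c * (\<Sum>i\<le>p. (v $ i)\<^sup>2)"
      by (simp add: corr_form_def sum.distrib sum_distrib_left)
    finally have "\<beta> * corr_form a p (($) v) + c * (\<Sum>i\<le>p. (v $ i)\<^sup>2) = 0" ..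
    moreover have "0 \<le> \<beta> * corr_form a p (($) v)" using assms by (simp add: corr_form_nonneg)
    moreover have "0 \<le> c * (\<Sum>i\<le>p. (v $ i)\<^sup>2)" using assms by (simp add: sum_nonneg)
    ultimately have "c * (\<Sum>i\<le>p. (v $ i)\<^sup>2) = 0" by linarith
    then have "\<forall>i\<le>p. v $ i = 0" using assms by (simp add: sum_nonneg_eq_0_iff)
    then have "v = 0\<^sub>v (p + 1)" using v(1) by (intro eq_vecI) auto
    with v(2) show False by simp
  qed
  from det_non_zero_imp_unit[OF S this, of "()"]
  have "mat_inverse S \<noteq> None" using mat_inverse(1)[OF S, of "()"] by blast
  then show ?thesis using mat_inverse(2)[OF S] that by blast
qed

text \<open>\<open>T_mat\<close> is the small matrix \<open>S\<close> tensored with the identity,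
  hence so is its inverse. Every antenna is filtered by the same row of weights and
  \<open>Theta_mat\<close> is scalar.\<close>

lemma predictor_matrices:
  assumes \<beta>: "0 < \<beta>" and pp: "0 < pp" and a: "\<bar>a\<bar> \<le> 1"
  obtains r where "normal_eq a p \<beta> (1 / pp) r"
    and "q_mat M p a \<beta> pp = Matrix.mat M ((p + 1) * M)
      (\<lambda>(m, i). if m = i mod M then a * \<beta> * r (i div M) else 0)"
    and "Theta_mat M p a \<beta> pp = (\<beta>\<^sup>2 * (\<Sum>j\<le>p. r j * a ^ j)) \<cdot>\<^sub>m 1\<^sub>m M"
proof -
  let ?n = "p + 1" and ?\<delta> = "delta_row p a"
  define S where "S = \<beta> \<cdot>\<^sub>m Delta_mat p a + (1 / pp) \<cdot>\<^sub>m 1\<^sub>m ?n"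
  obtain S' where S': "S' \<in> carrier_mat ?n ?n" "S * S' = 1\<^sub>m ?n" "S' * S = 1\<^sub>m ?n"
    using prediction_gram_inverse[of \<beta> "1 / pp" a p] \<beta> pp a unfolding S_def by auto
  have S: "S \<in> carrier_mat ?n ?n" by (simp add: S_def Delta_mat_def)
  have \<delta>: "?\<delta> \<in> carrier_mat 1 ?n" by (simp add: delta_row_def)
  have T: "T_mat M p a \<beta> pp = kron S (1\<^sub>m M)"
  proof (rule eq_matI)
    fix i j assume "i < dim_row (kron S (1\<^sub>m M))" "j < dim_col (kron S (1\<^sub>m M))"
    then have ij: "i < ?n * M" "j < ?n * M" using S by auto
    then show "T_mat M p a \<beta> pp $$ (i, j) = kron S (1\<^sub>m M) $$ (i, j)"
      using div_mod_eq_iff[of i M j] less_mult_imp_div_less[OF ij(1)] less_mult_imp_div_less[OF ij(2)]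
      by (auto simp: T_mat_def S_def kron_one_index Delta_mat_def mult.commute[of M])
  qed (use S in \<open>simp_all add: T_mat_def mult.commute[of M]\<close>)
  have inv: "mat_inverse (T_mat M p a \<beta> pp) = Some (kron S' (1\<^sub>m M))"
    unfolding T
    by (rule mat_inverse_eq_Some[of _ "?n * M"])
      (use S S' in \<open>auto simp: kron_one_mult kron_one_one carrier_matD intro!: carrier_matI\<close>)
  \<comment> \<open>This is the row \<delta> times the inverse of \<open>S\<close>; multiplying it
    by \<open>S\<close> on the right gives the normal equations.\<close>
  define r where "r j = (?\<delta> * S') $$ (0, j)" for j
  have \<delta>S': "?\<delta> * S' \<in> carrier_mat 1 ?n" using \<delta> S' by simp
  show ?thesis
  proof (rule that[of r])
    have "?\<delta> * S' * S = ?\<delta>" using \<delta> S S' by (simp add: assoc_mult_mat[of _ 1 ?n _ ?n _ ?n])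
    then have eq: "(?\<delta> * S' * S) $$ (0, j) = ?\<delta> $$ (0, j)" for j by simp
    show "normal_eq a p \<beta> (1 / pp) r"
      unfolding normal_eq_def
    proof (intro allI impI)
      fix j assume j: "j \<le> p"
      have "(?\<delta> * S' * S) $$ (0, j) = (\<Sum>i\<le>p. r i * S $$ (i, j))"
        using carrier_matD[OF \<delta>S'] carrier_matD[OF S] j
        by (subst index_mult_mat_sum) (simp_all add: r_def lessThan_Suc_atMost del: index_mult_mat(1))
      also have "\<dots> = (\<Sum>i\<le>p. \<beta> * (r i * a ^ nat \<bar>int i - int j\<bar>) + (if i = j then r i / pp else 0))"
        using j by (intro sum.cong refl) (auto simp: S_def Delta_mat_def algebra_simps)
      also have "\<dots> = \<beta> * (\<Sum>i\<le>p. r i * a ^ nat \<bar>int i - int j\<bar>) + 1 / pp * r j"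
        using j by (simp add: sum.distrib sum_distrib_left)
      finally show "\<beta> * (\<Sum>i\<le>p. r i * a ^ nat \<bar>int i - int j\<bar>) + 1 / pp * r j = a ^ j"
        using eq[of j] j by (simp add: delta_row_def)
    qed
    have k: "kron ?\<delta> (1\<^sub>m M) * kron S' (1\<^sub>m M) = kron (?\<delta> * S') (1\<^sub>m M)"
      using \<delta> S' by (intro kron_one_mult) auto
    show "q_mat M p a \<beta> pp = Matrix.mat M (?n * M) (\<lambda>(m, i). if m = i mod M then a * \<beta> * r (i div M) else 0)"
      unfolding q_mat_def inv option.sel k
    proof (rule eq_matI)
      fix m i assume "m < dim_row (Matrix.mat M (?n * M) (\<lambda>(m, i). if m = i mod M then a * \<beta> * r (i div M) else 0))"
        "i < dim_col (Matrix.mat M (?n * M) (\<lambda>(m, i). if m = i mod M then a * \<beta> * r (i div M) else 0))"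
      then have mi: "m < M" "i < ?n * M" by simp_all
      then have "kron (?\<delta> * S') (1\<^sub>m M) $$ (m, i) = (if m = i mod M then r (i div M) else 0)"
        using \<delta>S' by (subst kron_one_index) (auto simp: r_def)
      moreover have "m < dim_row (kron (?\<delta> * S') (1\<^sub>m M))" "i < dim_col (kron (?\<delta> * S') (1\<^sub>m M))"
        using mi carrier_matD[OF \<delta>S'] by simp_all
      ultimately show "((a * \<beta>) \<cdot>\<^sub>m kron (?\<delta> * S') (1\<^sub>m M)) $$ (m, i) =
          Matrix.mat M (?n * M) (\<lambda>(m, i). if m = i mod M then a * \<beta> * r (i div M) else 0) $$ (m, i)"
        using mi by (simp del: kron_one_carrier)
    qed (use carrier_matD[OF \<delta>S'] in simp_all)
    have adj: "mat_adjoint (kron ?\<delta> (1\<^sub>m M)) = kron (transpose_mat ?\<delta>) (1\<^sub>m M)"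
      by (rule eq_matI)
        (use \<delta> in \<open>auto simp: mat_adjoint_def mat_of_rows_index kron_one_index less_mult_imp_div_less\<close>)
    have \<delta>t: "transpose_mat ?\<delta> \<in> carrier_mat ?n 1" using \<delta> by simp
    have k2: "kron (?\<delta> * S') (1\<^sub>m M) * kron (transpose_mat ?\<delta>) (1\<^sub>m M) =
        kron (?\<delta> * S' * transpose_mat ?\<delta>) (1\<^sub>m M)"
      using \<delta>S' \<delta>t by (intro kron_one_mult) auto
    have c: "?\<delta> * S' * transpose_mat ?\<delta> \<in> carrier_mat 1 1" using \<delta>S' \<delta>t by simp
    have "(?\<delta> * S' * transpose_mat ?\<delta>) $$ (0, 0) = (\<Sum>j\<le>p. r j * a ^ j)"
      using carrier_matD[OF \<delta>S'] carrier_matD[OF \<delta>t]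
      by (subst index_mult_mat_sum)
        (simp_all add: r_def delta_row_def lessThan_Suc_atMost del: index_mult_mat(1))
    then have "kron (?\<delta> * S' * transpose_mat ?\<delta>) (1\<^sub>m M) = (\<Sum>j\<le>p. r j * a ^ j) \<cdot>\<^sub>m 1\<^sub>m M"
      using carrier_matD[OF c] by (intro eq_matI) (auto simp: kron_one_index)
    then show "Theta_mat M p a \<beta> pp = (\<beta>\<^sup>2 * (\<Sum>j\<le>p. r j * a ^ j)) \<cdot>\<^sub>m 1\<^sub>m M"
      unfolding Theta_mat_def inv option.sel k adj k2 by (intro eq_matI) auto
  qed
qed

section \<open>The Jensen step\<close>

text \<open>The left side is the tangent at \<open>u0\<close> of the convex map taking
  \<open>u\<close> to \<open>ln (1 + 1 / u)\<close>.\<close>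

lemma ln_one_plus_inverse_tangent:
  fixes u u0 :: real
  assumes "0 < u" "0 < u0"
  shows "ln (1 + 1 / u0) + (u0 - u) / ((u0 + 1) * u0) \<le> ln (1 + 1 / u)"
proof -
  \<comment> \<open>The quotient of \<open>1 + 1 / u0\<close> by \<open>1 + 1 / u\<close>. Here
    \<open>ln ?z \<le> ?z - 1\<close> gives the claim with \<open>u + 1\<close> in the denominator;
    changing it to \<open>u0 + 1\<close> costs a nonnegative square.\<close>
  let ?z = "(u * (u0 + 1)) / ((u + 1) * u0)"
  have z: "0 < ?z" using assms by simp
  have "(u0 - u) / ((u0 + 1) * u0) \<le> (u0 - u) / ((u + 1) * u0)"
  proof -
    have "(u0 - u) / ((u + 1) * u0) - (u0 - u) / ((u0 + 1) * u0) = (u0 - u)\<^sup>2 / ((u + 1) * (u0 + 1) * u0)"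
      using assms by (simp add: divide_simps add_pos_pos) (simp add: algebra_simps power2_eq_square)
    moreover have "0 \<le> (u0 - u)\<^sup>2 / ((u + 1) * (u0 + 1) * u0)" using assms by simp
    ultimately show ?thesis by linarith
  qed
  also have "(u0 - u) / ((u + 1) * u0) = ((u + 1) * u0 - u * (u0 + 1)) / ((u + 1) * u0)"
    by (simp add: algebra_simps)
  also have "\<dots> = 1 - ?z"
    using assms by (simp add: diff_divide_distrib)
  also have "\<dots> \<le> - ln ?z" using ln_le_minus_one[OF z] by simp
  also have "- ln ?z = ln (1 + 1 / u) - ln (1 + 1 / u0)"
  proof -
    have "1 + 1 / u = (u + 1) / u" "1 + 1 / u0 = (u0 + 1) / u0" using assms by (simp_all add: field_simps)
    then show ?thesis using assms by (simp add: ln_div ln_mult)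
  qed
  finally show ?thesis by simp
qed

context prob_space begin

text \<open>Jensen by integrating the tangent at \<open>u0\<close>. Its slope is negative, so an
  upper bound on the mean of \<open>u\<close> suffices. Integrability of \<open>s\<close> passes to
  the logarithm by \<open>ln (1 + s) \<le> s\<close>.\<close>

lemma expectation_log_ge:
  assumes u [measurable]: "random_variable borel u" and u_pos: "AE \<omega> in M. 0 < u \<omega>"
    and u_int: "(\<integral>\<^sup>+\<omega>. ennreal (u \<omega>) \<partial>M) \<le> ennreal u0" and u0: "0 < u0"
    and s: "AE \<omega> in M. s \<omega> = 1 / u \<omega>" and s_int: "integrable M s"
  shows "log 2 (1 + 1 / u0) \<le> expectation (\<lambda>\<omega>. log 2 (1 + s \<omega>))"
proof -
  have [measurable]: "random_variable borel s" using s_int by simp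
  have u_nn: "AE \<omega> in M. 0 \<le> u \<omega>" using u_pos by eventually_elim simp
  have fin: "(\<integral>\<^sup>+\<omega>. ennreal (u \<omega>) \<partial>M) < \<infinity>" using u_int by (rule le_less_trans) simp
  have iu: "integrable M u"
    using fin u_nn by (intro integrableI_nonneg) auto
  have Eu: "expectation u \<le> u0"
    using u_int u0 nn_integral_eq_integral[OF iu u_nn] by simp
  have il: "integrable M (\<lambda>\<omega>. ln (1 + s \<omega>))"
  proof (rule Bochner_Integration.integrable_bound[OF s_int])
    show "AE \<omega> in M. norm (ln (1 + s \<omega>)) \<le> norm (s \<omega>)"
      using s u_pos
    proof eventually_elim
      case (elim \<omega>)
      then have "0 < s \<omega>" by simp
      then show ?case using ln_add_one_self_le_self[of "s \<omega>"] by simp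
    qed
  qed measurable
  have "ln (1 + 1 / u0) \<le> ln (1 + 1 / u0) + (u0 - expectation u) / ((u0 + 1) * u0)"
    using Eu u0 by simp
  also have "\<dots> = expectation (\<lambda>\<omega>. ln (1 + 1 / u0) + (u0 - u \<omega>) / ((u0 + 1) * u0))"
    using iu by (simp add: prob_space)
  also have "\<dots> \<le> expectation (\<lambda>\<omega>. ln (1 + s \<omega>))"
  proof (rule integral_mono_AE)
    show "AE \<omega> in M. ln (1 + 1 / u0) + (u0 - u \<omega>) / ((u0 + 1) * u0) \<le> ln (1 + s \<omega>)"
      using s u_pos by eventually_elim (simp add: ln_one_plus_inverse_tangent[OF _ u0])
  qed (use iu il in simp_all)
  finally show ?thesis by (simp add: log_def divide_right_mono)
qed

lemma mrc_rate_bound: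
  fixes A :: "'i \<Rightarrow> nat \<Rightarrow> 'a \<Rightarrow> complex"
  assumes I: "finite I" "k \<in> I" and m: "1 \<le> m" and pu: "0 < pu" and C: "0 < C"
    and A: "\<And>i. i \<in> I \<Longrightarrow> cn_family (A i) m (\<sigma> i)" and \<sigma>: "\<And>i. i \<in> I \<Longrightarrow> 0 \<le> \<sigma> i"
    and ind: "\<And>i. i \<in> I - {k} \<Longrightarrow> indep_var (\<Pi>\<^sub>M j\<in>{..<m}. borel) (\<lambda>\<omega>. \<lambda>j\<in>{..<m}. A k j \<omega>)
      (\<Pi>\<^sub>M j\<in>{..<m}. borel) (\<lambda>\<omega>. \<lambda>j\<in>{..<m}. A i j \<omega>)"
  defines "R \<equiv> \<lambda>\<omega>. \<Sum>j<m. (cmod (A k j \<omega>))\<^sup>2"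
    and "S \<equiv> \<lambda>\<omega>. \<Sum>i\<in>I - {k}. (cmod (\<Sum>j<m. A i j \<omega> * cnj (A k j \<omega>)))\<^sup>2"
  shows "log 2 (1 + pu * (real m - 1) * \<sigma> k / (pu * (\<Sum>i\<in>I - {k}. \<sigma> i) + C))
    \<le> expectation (\<lambda>\<omega>. log 2 (1 + pu * (R \<omega>)\<^sup>2 / (pu * S \<omega> + R \<omega> * C)))"
    (is "?bound \<le> expectation (\<lambda>\<omega>. log 2 (1 + ?s \<omega>))")
proof (cases "2 \<le> m \<and> 0 < \<sigma> k")
  \<comment> \<open>No usable inverse moment here: it is infinite for m = 1 with positive variance,
    and \<sigma> k = 0 makes \<open>R\<close> vanish almost surely. The numerator of the bound is
    0.\<close>
  case False
  then have 0: "(real m - 1) * \<sigma> k = 0" using m \<sigma>[OF I(2)] by (auto simp: not_le)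
  have "?bound = 0" using 0 by (simp only: mult.assoc) simp
  moreover have "0 \<le> ?s \<omega>" for \<omega>
    using pu C by (intro divide_nonneg_nonneg mult_nonneg_nonneg add_nonneg_nonneg)
      (auto simp: R_def S_def intro!: sum_nonneg)
  then have "0 \<le> expectation (\<lambda>\<omega>. log 2 (1 + ?s \<omega>))"
    by (intro Bochner_Integration.integral_nonneg) (auto simp: log_def intro!: divide_nonneg_pos ln_ge_zero)
  ultimately show ?thesis by simp
next
  case True
  then have m2: "2 \<le> m" and \<sigma>k: "0 < \<sigma> k" by auto
  have rv [measurable]: "random_variable borel (A i j)" if "i \<in> I" "j \<in> {..<m}" for i j
    using cn_family_rv[OF A[OF that(1)]] that(2) by simp
  have k [measurable]: "k \<in> I" by fact
  have R_rv [measurable]: "random_variable borel R" unfolding R_def by measurable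
  define Q where "Q i \<omega> = (cmod (\<Sum>j<m. A i j \<omega> * cnj (A k j \<omega>)))\<^sup>2" for i \<omega>
  have Q_rv [measurable]: "random_variable borel (Q i)" if "i \<in> I - {k}" for i
  proof -
    have i [measurable]: "i \<in> I" using that by simp
    have "cnj \<in> borel_measurable borel" by (intro borel_measurable_continuous_onI continuous_intros)
    from measurable_compose[OF rv[OF k] this]
    have [measurable]: "random_variable borel (\<lambda>\<omega>. cnj (A k j \<omega>))" if "j \<in> {..<m}" for j
      using that .
    show ?thesis unfolding Q_def by measurable
  qed
  have S_Q: "S \<omega> = (\<Sum>i\<in>I - {k}. Q i \<omega>)" for \<omega> by (simp add: S_def Q_def)
  have S_rv [measurable]: "random_variable borel S" unfolding S_Q[abs_def] by measurable
  have nn: "0 \<le> R \<omega>" "0 \<le> S \<omega>" "0 \<le> Q i \<omega>" for i \<omega> by (auto simp: R_def S_def Q_def intro!: sum_nonneg)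
  define J where "J = (\<integral>\<^sup>+\<omega>. ennreal (1 / R \<omega>) \<partial>M)"
  have J: "J \<le> ennreal (1 / ((real m - 1) * \<sigma> k))"
    unfolding J_def R_def by (rule cn_family_inverse_sq(1)[OF A[OF k] \<sigma>k m2])
  have R_pos: "AE \<omega> in M. 0 < R \<omega>"
    unfolding R_def by (rule cn_family_inverse_sq(2)[OF A[OF k] \<sigma>k m2])
  define s0 where "s0 = (\<Sum>i\<in>I - {k}. \<sigma> i)"
  have s0: "0 \<le> s0" unfolding s0_def using \<sigma> by (intro sum_nonneg) auto
  \<comment> \<open>An upper bound for the mean of \<open>u\<close>, chosen so that
    \<open>1 / u0\<close> is exactly the fraction inside the claimed bound.\<close>
  define u0 where "u0 = (s0 + C / pu) * (1 / ((real m - 1) * \<sigma> k))"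
  have c0: "0 < s0 + C / pu" using s0 C pu by (simp add: add_nonneg_pos)
  have u0: "0 < u0" unfolding u0_def using c0 m2 \<sigma>k by simp
  \<comment> \<open>The reciprocal of the SINR wherever \<open>R\<close> is positive, after division
    by \<open>pu * (R \<omega>)^2\<close>.\<close>
  define u where "u \<omega> = S \<omega> / (R \<omega>)\<^sup>2 + C / pu * (1 / R \<omega>)" for \<omega>
  have [measurable]: "random_variable borel u" unfolding u_def by measurable
  have "(\<integral>\<^sup>+\<omega>. ennreal (u \<omega>) \<partial>M) =
      (\<integral>\<^sup>+\<omega>. (\<Sum>i\<in>I - {k}. ennreal (Q i \<omega> / (R \<omega>)\<^sup>2)) + ennreal (C / pu) * ennreal (1 / R \<omega>) \<partial>M)"
  proof (rule nn_integral_cong)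
    fix \<omega>
    have "u \<omega> = (\<Sum>i\<in>I - {k}. Q i \<omega> / (R \<omega>)\<^sup>2) + C / pu * (1 / R \<omega>)"
      by (simp add: u_def S_Q sum_divide_distrib)
    then show "ennreal (u \<omega>) = (\<Sum>i\<in>I - {k}. ennreal (Q i \<omega> / (R \<omega>)\<^sup>2)) + ennreal (C / pu) * ennreal (1 / R \<omega>)"
      using nn C pu by (simp add: ennreal_plus[symmetric] ennreal_mult'[symmetric] sum_nonneg del: ennreal_plus)
  qed
  also have "\<dots> = (\<Sum>i\<in>I - {k}. \<integral>\<^sup>+\<omega>. ennreal (Q i \<omega> / (R \<omega>)\<^sup>2) \<partial>M) + ennreal (C / pu) * J"
    unfolding J_def by (simp add: nn_integral_add nn_integral_sum nn_integral_cmult)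
  also have "(\<Sum>i\<in>I - {k}. \<integral>\<^sup>+\<omega>. ennreal (Q i \<omega> / (R \<omega>)\<^sup>2) \<partial>M) = (\<Sum>i\<in>I - {k}. ennreal (\<sigma> i) * J)"
    unfolding Q_def R_def J_def
    by (intro sum.cong refl cn_family_projection[OF ind A \<sigma>]) auto
  also have "\<dots> + ennreal (C / pu) * J = ennreal (s0 + C / pu) * J"
  proof -
    have "(\<Sum>i\<in>I - {k}. ennreal (\<sigma> i)) = ennreal s0" unfolding s0_def using \<sigma> by (intro sum_ennreal) auto
    then show ?thesis using s0 C pu by (simp add: sum_distrib_right[symmetric] distrib_right[symmetric])
  qed
  also have "\<dots> \<le> ennreal (s0 + C / pu) * ennreal (1 / ((real m - 1) * \<sigma> k))"
    by (rule mult_left_mono[OF J]) simp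
  also have "\<dots> = ennreal u0" unfolding u0_def using c0 by (subst ennreal_mult') simp_all
  finally have u_int: "(\<integral>\<^sup>+\<omega>. ennreal (u \<omega>) \<partial>M) \<le> ennreal u0" .
  \<comment> \<open>Dropping the interference bounds the SINR by \<open>pu / C * R\<close>, and
    \<open>R\<close> has finite mean.\<close>
  have "integrable M R"
    by (rule integrableI_nonneg) (use nn cn_family_nn_integral_sq[OF A[OF k] \<sigma>[OF k]] in \<open>simp_all add: R_def\<close>)
  then have "integrable M (\<lambda>\<omega>. pu / C * R \<omega>)" by simp
  then have s_int: "integrable M ?s"
  proof (rule Bochner_Integration.integrable_bound)
    show "AE \<omega> in M. norm (?s \<omega>) \<le> norm (pu / C * R \<omega>)"
      using R_pos
    proof eventually_elim
      case (elim \<omega>)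
      have "?s \<omega> \<le> pu * (R \<omega>)\<^sup>2 / (R \<omega> * C)"
        using elim pu C nn by (intro divide_left_mono) (auto intro!: mult_pos_pos add_nonneg_pos)
      also have "\<dots> = pu / C * R \<omega>" using elim C by (simp add: field_simps power2_eq_square)
      finally show ?case using elim pu C nn by simp
    qed
  qed measurable
  have u_pos: "AE \<omega> in M. 0 < u \<omega>"
    using R_pos by eventually_elim (use nn C pu in \<open>auto simp: u_def intro!: add_nonneg_pos\<close>)
  have s: "AE \<omega> in M. ?s \<omega> = 1 / u \<omega>"
    using R_pos
  proof eventually_elim
    case (elim \<omega>)
    have "u \<omega> = (pu * S \<omega> + R \<omega> * C) / (pu * (R \<omega>)\<^sup>2)"
      using elim pu by (simp add: u_def field_simps power2_eq_square)
    then show ?case by simp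
  qed
  have "1 / u0 = pu * (real m - 1) * \<sigma> k / (pu * s0 + C)"
  proof -
    have "pu * (s0 + C / pu) = pu * s0 + C" using pu by (simp add: field_simps)
    then have "u0 = (pu * s0 + C) / (pu * ((real m - 1) * \<sigma> k))"
      using pu by (simp add: u0_def field_simps)
    then show ?thesis by (simp add: mult.assoc)
  qed
  then show ?thesis
    using expectation_log_ge[OF _ u_pos u_int u0 s s_int] by (simp add: s0_def)
qed

end

section \<open>The uplink model\<close>

context prob_space begin

lemma cn_family_of_indep:
  assumes "indep_vars (\<lambda>_. borel) A {..<m}" "\<And>i. i < m \<Longrightarrow> has_cn_law (A i) v"
  shows "cn_family A m v"
  unfolding cn_family_def by (rule indep_cn_parts) (use assms in auto)

lemma cn_family_cong:
  assumes A: "cn_family A m v" and eq: "\<And>i \<omega>. i < m \<Longrightarrow> \<omega> \<in> space M \<Longrightarrow> A i \<omega> = B i \<omega>"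
  shows "cn_family B m v"
  unfolding cn_family_def
  by (rule indep_normal_cong[OF A[unfolded cn_family_def]]) (use eq in auto)

lemma cn_family_cmult:
  assumes "cn_family A m v" "0 \<le> v"
  shows "cn_family (\<lambda>i \<omega>. complex_of_real c * A i \<omega>) m (c\<^sup>2 * v)"
  using indep_normal_cmult[OF assms(1)[unfolded cn_family_def], of c] assms(2)
  by (simp add: cn_family_def split_beta')

text \<open>Real coefficients do not mix real and imaginary parts, so the real statement transfers
  coordinatewise.\<close>

lemma cn_family_add:
  assumes ind: "indep_var (\<Pi>\<^sub>M i\<in>{..<m}. borel) (\<lambda>\<omega>. \<lambda>i\<in>{..<m}. A i \<omega>)
      (\<Pi>\<^sub>M i\<in>{..<m}. borel) (\<lambda>\<omega>. \<lambda>i\<in>{..<m}. B i \<omega>)"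
    and A: "cn_family A m v" "0 \<le> v" and B: "cn_family B m w" "0 \<le> w"
  shows "cn_family (\<lambda>i \<omega>. complex_of_real c * A i \<omega> + complex_of_real d * B i \<omega>) m (c\<^sup>2 * v + d\<^sup>2 * w)"
proof -
  let ?I = "{..<m} \<times> (UNIV :: bool set)"
  let ?f = "\<lambda>f. \<lambda>j\<in>?I. re_im (snd j) (f (fst j))"
  have f: "?f \<in> (\<Pi>\<^sub>M i\<in>{..<m}. borel) \<rightarrow>\<^sub>M (\<Pi>\<^sub>M j\<in>?I. borel)"
    by (intro measurable_restrict measurable_compose[OF _ re_im_measurable] measurable_component_singleton) auto
  have "indep_var (\<Pi>\<^sub>M j\<in>?I. borel) (\<lambda>\<omega>. \<lambda>j\<in>?I. re_im (snd j) (A (fst j) \<omega>))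
      (\<Pi>\<^sub>M j\<in>?I. borel) (\<lambda>\<omega>. \<lambda>j\<in>?I. re_im (snd j) (B (fst j) \<omega>))"
    using indep_var_compose[OF ind f f] by (simp add: comp_def mem_Times_iff cong: restrict_cong)
  from indep_normal_add[OF this, of "v / 2" "w / 2" c d] show ?thesis
    using A B by (simp add: cn_family_def split_beta' add_divide_distrib)
qed

lemma indep_vars_imp_indep_var:
  assumes "indep_vars N X I" "i \<in> I" "j \<in> I" "i \<noteq> j"
  shows "indep_var (N i) (X i) (N j) (X j)"
proof -
  have "indep_vars (\<lambda>b. N (case_bool i j b)) (\<lambda>b. X (case_bool i j b)) UNIV"
    by (rule indep_vars_reindex[OF assms(1)])
      (use assms(2-4) in \<open>auto simp: inj_on_def split: bool.splits\<close>)
  then show ?thesis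
    unfolding indep_var_def
    by (rule indep_vars_cong[THEN iffD1, rotated -1]) (auto split: bool.split)
qed

end

lemma mtrace_smult_one: "mtrace (c \<cdot>\<^sub>m 1\<^sub>m m :: real mat) = real m * c"
  by (simp add: mtrace_def)

section \<open>Laws of channel, noise and prediction in the uplink\<close>

context uplink begin

text \<open>Induction on \<open>p\<close> with time and weights general. Replacing the newest sample
  by \<alpha> times its predecessor plus an innovation moves its weight one step back; the
  innovation is independent of everything that remains.\<close>

lemma channel_combination:
  assumes k: "k \<in> {1..K}"
  shows "cn_family (\<lambda>m \<omega>. \<Sum>j\<le>p. complex_of_real (x j) * g k (n - int j) m \<omega>) M
    (\<beta> k * corr_form \<alpha> p x)"
proof (induction p arbitrary: n x)
  case 0
  from cn_family_cmult[OF cn_family_of_indep[OF g_indep_entries[OF k] g_law[OF k]], of "x 0" n]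
  show ?case using beta_pos[OF k] by (simp add: mult.commute)
next
  case (Suc p)
  define x' where "x' = (x \<circ> Suc)(0 := x 1 + \<alpha> * x 0)"
  let ?G = "\<lambda>m \<omega>. \<Sum>j\<le>p. complex_of_real (x' j) * g k (n - 1 - int j) m \<omega>"
  have e: "cn_family (e k n) M ((1 - \<alpha>\<^sup>2) * \<beta> k)"
    by (rule cn_family_of_indep[OF e_indep_entries[OF k] e_law[OF k]])
  have a: "\<alpha>\<^sup>2 \<le> 1" using alpha_le_1 by (simp add: abs_square_le_1)
  let ?H = "\<lambda>f. \<lambda>m\<in>{..<M}. \<Sum>j\<le>p. complex_of_real (x' j) * f (n - 1 - int j, m)"
  let ?F = "\<lambda>f. \<lambda>m\<in>{..<M}. f (n, m)"
  \<comment> \<open>\<open>e_indep_past\<close> is applied at time \<open>n - 1\<close>, hence the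
    shape \<open>n - 1 + 1\<close> for the time \<open>n\<close> of the innovation.\<close>
  have F: "?F \<in> (\<Pi>\<^sub>M i\<in>{n - 1 + 1} \<times> {..<M}. borel) \<rightarrow>\<^sub>M (\<Pi>\<^sub>M m\<in>{..<M}. (borel :: complex measure))"
    by (intro measurable_restrict measurable_component_singleton) auto
  have H: "?H \<in> (\<Pi>\<^sub>M i\<in>{..n - 1} \<times> {..<M}. borel) \<rightarrow>\<^sub>M (\<Pi>\<^sub>M m\<in>{..<M}. (borel :: complex measure))"
    by (intro measurable_restrict borel_measurable_sum borel_measurable_times borel_measurable_const
        measurable_component_singleton) auto
  have "indep_var (\<Pi>\<^sub>M m\<in>{..<M}. borel) (\<lambda>\<omega>. \<lambda>m\<in>{..<M}. e k n m \<omega>)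
      (\<Pi>\<^sub>M m\<in>{..<M}. borel) (\<lambda>\<omega>. \<lambda>m\<in>{..<M}. ?G m \<omega>)"
    using indep_var_compose[OF e_indep_past[OF k, of "n - 1"] F H]
    by (simp add: comp_def cong: restrict_cong)
  from cn_family_add[OF this e _ Suc.IH[of x' "n - 1"], of "x 0" 1]
  have "cn_family (\<lambda>m \<omega>. complex_of_real (x 0) * e k n m \<omega> + ?G m \<omega>) M
      ((x 0)\<^sup>2 * ((1 - \<alpha>\<^sup>2) * \<beta> k) + \<beta> k * corr_form \<alpha> p x')"
    using beta_pos[OF k] a corr_form_nonneg[OF alpha_le_1, of p x'] by simp
  also have "(x 0)\<^sup>2 * ((1 - \<alpha>\<^sup>2) * \<beta> k) + \<beta> k * corr_form \<alpha> p x' = \<beta> k * corr_form \<alpha> (Suc p) x"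
    by (simp add: corr_form_Suc x'_def algebra_simps)
  finally show ?case
  proof (rule cn_family_cong)
    fix m \<omega> assume m: "m < M" and \<omega>: "\<omega> \<in> space P"
    have "(\<Sum>j\<le>Suc p. complex_of_real (x j) * g k (n - int j) m \<omega>) =
        complex_of_real (x 0) * g k n m \<omega> + (\<Sum>j\<le>p. complex_of_real (x (Suc j)) * g k (n - 1 - int j) m \<omega>)"
      by (subst sum.atMost_Suc_shift) (simp add: algebra_simps)
    also have "g k n m \<omega> = complex_of_real \<alpha> * g k (n - 1) m \<omega> + e k n m \<omega>"
      using g_step[OF k m \<omega>, of "n - 1"] by simp
    also have "(\<Sum>j\<le>p. complex_of_real (x (Suc j)) * g k (n - 1 - int j) m \<omega>) =
        ?G m \<omega> - complex_of_real (\<alpha> * x 0) * g k (n - 1) m \<omega>"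
      by (cases p) (simp_all add: x'_def sum.atMost_Suc_shift algebra_simps del: sum.atMost_Suc)
    finally show "complex_of_real (x 0) * e k n m \<omega> + ?G m \<omega> =
        (\<Sum>j\<le>Suc p. complex_of_real (x j) * g k (n - int j) m \<omega>)"
      by (simp add: algebra_simps)
  qed
qed

text \<open>The noise is white, so the oldest sample is split off as a disjoint block of an
  independent family.\<close>

lemma noise_combination:
  assumes k: "k \<in> {1..K}"
  shows "cn_family (\<lambda>m \<omega>. \<Sum>j\<le>p. complex_of_real (x j) * b k (n - int j) m \<omega>) M (\<Sum>j\<le>p. (x j)\<^sup>2)"
proof (induction p)
  have "cn_family (b k n) M 1" for n
  proof (rule cn_family_of_indep)
    have "indep_vars (\<lambda>_. borel) (\<lambda>m. case (k, n, m) of (k, n, m) \<Rightarrow> b k n m) {..<M}"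
      by (rule indep_vars_reindex[OF b_indep, of "\<lambda>m. (k, n, m)"]) (use k in \<open>auto simp: inj_on_def\<close>)
    then show "indep_vars (\<lambda>_. borel) (b k n) {..<M}" by simp
  qed (use b_law k in auto)
  note b = this
  case 0
  from cn_family_cmult[OF b, of "x 0" n] show ?case by simp
  case (Suc p)
  let ?G = "\<lambda>m \<omega>. \<Sum>j\<le>p. complex_of_real (x j) * b k (n - int j) m \<omega>"
  let ?n = "n - int (Suc p)"
  let ?A = "{k} \<times> {?n<..n} \<times> {..<M}" and ?B = "{k} \<times> {?n} \<times> {..<M}"
  have ind: "indep_var (PiM ?A (\<lambda>_. borel)) (\<lambda>\<omega>. \<lambda>i\<in>?A. (case i of (k, n, m) \<Rightarrow> b k n m) \<omega>)
      (PiM ?B (\<lambda>_. borel)) (\<lambda>\<omega>. \<lambda>i\<in>?B. (case i of (k, n, m) \<Rightarrow> b k n m) \<omega>)"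
    by (rule indep_var_restrict[OF b_indep]) (use k in auto)
  let ?H = "\<lambda>f. \<lambda>m\<in>{..<M}. \<Sum>j\<le>p. complex_of_real (x j) * f (k, n - int j, m)"
  let ?F = "\<lambda>f. \<lambda>m\<in>{..<M}. f (k, ?n, m)"
  have H: "?H \<in> PiM ?A (\<lambda>_. borel) \<rightarrow>\<^sub>M (\<Pi>\<^sub>M m\<in>{..<M}. (borel :: complex measure))"
    by (intro measurable_restrict borel_measurable_sum borel_measurable_times borel_measurable_const
        measurable_component_singleton) auto
  have F: "?F \<in> PiM ?B (\<lambda>_. borel) \<rightarrow>\<^sub>M (\<Pi>\<^sub>M m\<in>{..<M}. (borel :: complex measure))"
    by (intro measurable_restrict measurable_component_singleton) auto
  have "indep_var (\<Pi>\<^sub>M m\<in>{..<M}. borel) (\<lambda>\<omega>. \<lambda>m\<in>{..<M}. ?G m \<omega>)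
      (\<Pi>\<^sub>M m\<in>{..<M}. borel) (\<lambda>\<omega>. \<lambda>m\<in>{..<M}. b k ?n m \<omega>)"
    using indep_var_compose[OF ind H F] by (simp add: comp_def cong: restrict_cong)
  from cn_family_add[OF this Suc _ b, of 1 "x (Suc p)"]
  show ?case by (simp add: sum_nonneg)
qed

text \<open>One map \<open>?H\<close> forms both the noise part and the channel part, so
  independence of the two arrays passes to the parts. The variance is the quadratic form of \<beta>
  \<Delta> plus \<open>c^2\<close> times the identity.\<close>

lemma observation_combination:
  assumes k: "k \<in> {1..K}"
  shows "cn_family (\<lambda>m \<omega>. \<Sum>j\<le>p. complex_of_real (x j) *
      (g k (n - int j) m \<omega> + complex_of_real c * b k (n - int j) m \<omega>)) M
    (\<beta> k * corr_form \<alpha> p x + c\<^sup>2 * (\<Sum>j\<le>p. (x j)\<^sup>2))"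
proof -
  let ?H = "\<lambda>f. \<lambda>m\<in>{..<M}. \<Sum>j\<le>p. complex_of_real (x j) * f (k, n - int j, m)"
  have H: "?H \<in> (\<Pi>\<^sub>M i\<in>{1..K} \<times> UNIV \<times> {..<M}. borel) \<rightarrow>\<^sub>M (\<Pi>\<^sub>M m\<in>{..<M}. (borel :: complex measure))"
    by (intro measurable_restrict borel_measurable_sum borel_measurable_times borel_measurable_const
        measurable_component_singleton) (use k in auto)
  have "indep_var (\<Pi>\<^sub>M m\<in>{..<M}. borel)
      (\<lambda>\<omega>. \<lambda>m\<in>{..<M}. \<Sum>j\<le>p. complex_of_real (x j) * b k (n - int j) m \<omega>)
      (\<Pi>\<^sub>M m\<in>{..<M}. borel)
      (\<lambda>\<omega>. \<lambda>m\<in>{..<M}. \<Sum>j\<le>p. complex_of_real (x j) * g k (n - int j) m \<omega>)"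
    using indep_var_compose[OF b_indep_g H H] k by (simp add: comp_def cong: restrict_cong)
  from cn_family_add[OF this noise_combination[OF k] _ channel_combination[OF k], of c 1]
  show ?thesis
    using beta_pos[OF k] corr_form_nonneg[OF alpha_le_1, of p x]
    by (simp add: sum_nonneg sum.distrib algebra_simps sum_distrib_left)
qed

text \<open>The noise row and the channel row are independent, and within each row so are the users.
  Hence all arrays are jointly independent and may be regrouped by user into pairs, to which
  \<open>H k\<close> applies.\<close>

lemma users_indep:
  assumes H: "\<And>k. k \<in> {1..K} \<Longrightarrow> H k \<in> (\<Pi>\<^sub>M i\<in>UNIV \<times> {..<M}. borel) \<Otimes>\<^sub>M (\<Pi>\<^sub>M i\<in>UNIV \<times> {..<M}. borel) \<rightarrow>\<^sub>M N k"
  shows "indep_vars N (\<lambda>k \<omega>. H k (\<lambda>(n, m)\<in>UNIV \<times> {..<M}. g k n m \<omega>, \<lambda>(n, m)\<in>UNIV \<times> {..<M}. b k n m \<omega>)) {1..K}"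
proof -
  define L where "L = (\<Pi>\<^sub>M i\<in>(UNIV :: int set) \<times> {..<M}. (borel :: complex measure))"
  \<comment> \<open>\<open>True\<close> selects the noise because \<open>b_indep_g\<close> lists it
    first.\<close>
  define Z where "Z c k \<omega> = (\<lambda>(n, m)\<in>UNIV \<times> {..<M}. (if c then b else g) k n m \<omega>)" for c k \<omega>
  let ?F = "\<lambda>f. \<lambda>k\<in>{1..K}. \<lambda>i\<in>(UNIV :: int set) \<times> {..<M}. f (k, i)"
  have F: "?F \<in> (\<Pi>\<^sub>M i\<in>{1..K} \<times> UNIV \<times> {..<M}. borel) \<rightarrow>\<^sub>M (\<Pi>\<^sub>M k\<in>{1..K}. L)"
    unfolding L_def by (intro measurable_restrict measurable_component_singleton) auto
  have "indep_var (\<Pi>\<^sub>M k\<in>{1..K}. L) (\<lambda>\<omega>. \<lambda>k\<in>{1..K}. Z True k \<omega>) (\<Pi>\<^sub>M k\<in>{1..K}. L) (\<lambda>\<omega>. \<lambda>k\<in>{1..K}. Z False k \<omega>)"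
    using indep_var_compose[OF b_indep_g F F]
    by (simp add: comp_def Z_def split_beta' mem_Times_iff cong: restrict_cong)
  then have outer: "indep_vars (\<lambda>c. \<Pi>\<^sub>M k\<in>{1..K}. L) (\<lambda>c \<omega>. \<lambda>k\<in>{1..K}. Z c k \<omega>) UNIV"
    unfolding indep_var_def
    by (rule indep_vars_cong[THEN iffD1, rotated -1]) (auto split: bool.split)
  have inner: "indep_vars (\<lambda>_. L) (Z c) {1..K}" for c
  proof (cases c)
    case False
    then show ?thesis using g_indep_users by (simp add: Z_def[abs_def] L_def)
  next
    case True
    have "indep_vars (\<lambda>k. PiM ({k} \<times> UNIV \<times> {..<M}) (\<lambda>_. borel))
        (\<lambda>k \<omega>. \<lambda>i\<in>{k} \<times> UNIV \<times> {..<M}. (case i of (k, n, m) \<Rightarrow> b k n m) \<omega>) {1..K}"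
      by (rule indep_vars_restrict[OF b_indep]) (auto simp: disjoint_family_on_def)
    from indep_vars_compose2[OF this, of "\<lambda>k f. \<lambda>i\<in>UNIV \<times> {..<M}. f (k, i)" "\<lambda>_. L"]
    have "indep_vars (\<lambda>_. L) (\<lambda>k \<omega>. \<lambda>i\<in>UNIV \<times> {..<M}.
        (\<lambda>i\<in>{k} \<times> UNIV \<times> {..<M}. (case i of (k, n, m) \<Rightarrow> b k n m) \<omega>) (k, i)) {1..K}"
      unfolding L_def by (simp add: measurable_restrict measurable_component_singleton)
    then show ?thesis
      using True by (simp add: Z_def[abs_def] split_beta' mem_Times_iff cong: restrict_cong)
  qed
  have "indep_vars (\<lambda>(c, k). L) (\<lambda>(c, k). Z c k) (UNIV \<times> {1..K})"
    by (rule indep_vars_Sigma[OF outer inner])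
  then have "indep_vars (\<lambda>k. PiM (UNIV \<times> {k}) (\<lambda>(c, k). L))
      (\<lambda>k \<omega>. \<lambda>i\<in>UNIV \<times> {k}. (case i of (c, k) \<Rightarrow> Z c k) \<omega>) {1..K}"
    by (rule indep_vars_restrict) (auto simp: disjoint_family_on_def)
  moreover have "(\<lambda>f. H k (f (False, k), f (True, k))) \<in> PiM (UNIV \<times> {k}) (\<lambda>(c, k). L) \<rightarrow>\<^sub>M N k"
    if k: "k \<in> {1..K}" for k
  proof -
    have c: "(\<lambda>f. f (c, k)) \<in> PiM (UNIV \<times> {k}) (\<lambda>(c, k). L) \<rightarrow>\<^sub>M L" for c
      using measurable_component_singleton[of "(c, k)" "UNIV \<times> {k}" "\<lambda>(c, k). L"] by simp
    show ?thesis
      by (rule measurable_compose[OF measurable_Pair[OF c c] H[OF k, folded L_def]])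
  qed
  ultimately have "indep_vars N (\<lambda>k \<omega>. (\<lambda>f. H k (f (False, k), f (True, k)))
      (\<lambda>i\<in>UNIV \<times> {k}. (case i of (c, k) \<Rightarrow> Z c k) \<omega>)) {1..K}"
    by (rule indep_vars_compose2)
  then show ?thesis by (simp add: Z_def)
qed

lemma pp_pos:
  assumes "k \<in> {1..K}"
  shows "0 < pp"
  using assms K_le_tau pu_pos by (simp add: pp_def)

text \<open>Row \<open>m\<close> of \<open>q_mat\<close> meets only stacked entries with
  \<open>i mod M = m\<close>, the samples of antenna \<open>m\<close>; this is why entries of the
  prediction inherit independence over antennas.\<close>

lemma prediction_combination:
  assumes q: "q_mat M p \<alpha> (\<beta> k) pp = Matrix.mat M ((p + 1) * M) (\<lambda>(m, i). if m = i mod M then w (i div M) else 0)"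
    and m: "m < M"
  shows "g_pred p k n \<omega> $ m = (\<Sum>j\<le>p. complex_of_real (w j) *
    (g k (n - 1 - int j) m \<omega> + complex_of_real (1 / sqrt pp) * b k (n - 1 - int j) m \<omega>))"
proof -
  let ?N = "(p + 1) * M"
  have dim: "dim_vec (y_stack p k (n - 1) \<omega>) = ?N"
    by (simp add: y_stack_def mult.commute)
  have "g_pred p k n \<omega> $ m = (\<Sum>i<?N. complex_of_real (if m = i mod M then w (i div M) else 0) * y_stack p k (n - 1) \<omega> $ i)"
    unfolding g_pred_def q using m
    by (simp add: scalar_prod_def dim lessThan_atLeast0 del: mult_Suc)
  also have "\<dots> = (\<Sum>i<?N. (\<lambda>j l. if m = l then complex_of_real (w j) * y_obs k (n - 1 - int j) \<omega> $ l else 0)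
      (i div M) (i mod M))"
  proof (rule sum.cong[OF refl])
    fix i assume "i \<in> {..<?N}"
    then have "y_stack p k (n - 1) \<omega> $ i = y_obs k (n - 1 - int (i div M)) \<omega> $ (i mod M)"
      unfolding y_stack_def by (subst index_vec) (simp_all add: mult.commute)
    then show "complex_of_real (if m = i mod M then w (i div M) else 0) * y_stack p k (n - 1) \<omega> $ i =
        (\<lambda>j l. if m = l then complex_of_real (w j) * y_obs k (n - 1 - int j) \<omega> $ l else 0) (i div M) (i mod M)"
      by simp
  qed
  also have "\<dots> = (\<Sum>j<p + 1. \<Sum>l<M. if m = l then complex_of_real (w j) * y_obs k (n - 1 - int j) \<omega> $ l else 0)"
    by (rule sum_div_mod)
  also have "\<dots> = (\<Sum>j\<le>p. complex_of_real (w j) * y_obs k (n - 1 - int j) \<omega> $ m)"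
    using m by (simp add: sum.delta lessThan_Suc_atMost)
  finally show ?thesis using m by (simp add: y_obs_def)
qed

lemma g_pred_law:
  obtains \<sigma> where "\<And>k. k \<in> {1..K} \<Longrightarrow> cn_family (\<lambda>m \<omega>. g_pred p k n \<omega> $ m) M (\<sigma> k)"
    and "\<And>k. k \<in> {1..K} \<Longrightarrow> 0 \<le> \<sigma> k" and "\<And>k. k \<in> {1..K} \<Longrightarrow> \<sigma> k \<le> \<beta> k"
    and "\<And>k. k \<in> {1..K} \<Longrightarrow> \<alpha>\<^sup>2 \<cdot>\<^sub>m \<Theta> p k = \<sigma> k \<cdot>\<^sub>m 1\<^sub>m M"
    and "indep_vars (\<lambda>_. \<Pi>\<^sub>M m\<in>{..<M}. borel) (\<lambda>k \<omega>. \<lambda>m\<in>{..<M}. g_pred p k n \<omega> $ m) {1..K}"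
proof -
  let ?W = "\<lambda>k r (m, i). if m = i mod M then \<alpha> * \<beta> k * r (i div M) else 0"
  have "\<forall>k\<in>{1..K}. \<exists>r. normal_eq \<alpha> p (\<beta> k) (1 / pp) r
      \<and> q_mat M p \<alpha> (\<beta> k) pp = Matrix.mat M ((p + 1) * M) (?W k r)
      \<and> Theta_mat M p \<alpha> (\<beta> k) pp = ((\<beta> k)\<^sup>2 * (\<Sum>j\<le>p. r j * \<alpha> ^ j)) \<cdot>\<^sub>m 1\<^sub>m M"
  proof
    fix k assume k: "k \<in> {1..K}"
    show "\<exists>r. normal_eq \<alpha> p (\<beta> k) (1 / pp) r
      \<and> q_mat M p \<alpha> (\<beta> k) pp = Matrix.mat M ((p + 1) * M) (?W k r)
      \<and> Theta_mat M p \<alpha> (\<beta> k) pp = ((\<beta> k)\<^sup>2 * (\<Sum>j\<le>p. r j * \<alpha> ^ j)) \<cdot>\<^sub>m 1\<^sub>m M"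
      by (rule predictor_matrices[OF beta_pos[OF k] pp_pos[OF k] alpha_le_1, of p M]) blast
  qed
  from bchoice[OF this] obtain r where all: "\<forall>k\<in>{1..K}. normal_eq \<alpha> p (\<beta> k) (1 / pp) (r k)
      \<and> q_mat M p \<alpha> (\<beta> k) pp = Matrix.mat M ((p + 1) * M) (?W k (r k))
      \<and> Theta_mat M p \<alpha> (\<beta> k) pp = ((\<beta> k)\<^sup>2 * (\<Sum>j\<le>p. r k j * \<alpha> ^ j)) \<cdot>\<^sub>m 1\<^sub>m M" ..
  have r: "normal_eq \<alpha> p (\<beta> k) (1 / pp) (r k)"
    and q: "q_mat M p \<alpha> (\<beta> k) pp = Matrix.mat M ((p + 1) * M) (?W k (r k))"
    and \<Theta>: "Theta_mat M p \<alpha> (\<beta> k) pp = ((\<beta> k)\<^sup>2 * (\<Sum>j\<le>p. r k j * \<alpha> ^ j)) \<cdot>\<^sub>m 1\<^sub>m M"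
    if "k \<in> {1..K}" for k
    using bspec[OF all that] by blast+
  define t where "t k = (\<Sum>j\<le>p. r k j * \<alpha> ^ j)" for k
  \<comment> \<open>The diagonal value of \<alpha>^2 \<Theta>, with \<open>t\<close> the scalar
    \<delta> r.\<close>
  define \<sigma> where "\<sigma> k = \<alpha>\<^sup>2 * ((\<beta> k)\<^sup>2 * t k)" for k
  let ?h = "\<lambda>k f m. \<Sum>j\<le>p. complex_of_real (\<alpha> * \<beta> k * r k j) *
      (fst f (n - 1 - int j, m) + complex_of_real (1 / sqrt pp) * snd f (n - 1 - int j, m))"
  have pred: "g_pred p k n \<omega> $ m = (\<Sum>j\<le>p. complex_of_real (\<alpha> * \<beta> k * r k j) *
      (g k (n - 1 - int j) m \<omega> + complex_of_real (1 / sqrt pp) * b k (n - 1 - int j) m \<omega>))"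
    if "k \<in> {1..K}" "m < M" for k m \<omega>
    by (rule prediction_combination) (use q that in auto)
  show ?thesis
  proof (rule that[of \<sigma>])
    fix k assume k: "k \<in> {1..K}"
    note tb = normal_eq_bounds[OF r[OF k] alpha_le_1 beta_pos[OF k], folded t_def]
    have pp0: "0 < pp" using pp_pos[OF k] .
    show "0 \<le> \<sigma> k" unfolding \<sigma>_def using tb(1) pp0 by simp
    have "(\<beta> k)\<^sup>2 * t k = \<beta> k * (\<beta> k * t k)" by (simp add: power2_eq_square)
    also have "\<dots> \<le> \<beta> k" using tb(2) pp0 beta_pos[OF k] mult_left_mono[of "\<beta> k * t k" 1 "\<beta> k"] by simp
    finally have "(\<beta> k)\<^sup>2 * t k \<le> \<beta> k" .
    moreover have "\<alpha>\<^sup>2 \<le> 1" using alpha_le_1 by (simp add: abs_square_le_1)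
    moreover have "0 \<le> (\<beta> k)\<^sup>2 * t k" using tb(1) pp0 by simp
    ultimately show "\<sigma> k \<le> \<beta> k"
      unfolding \<sigma>_def using mult_right_mono[of "\<alpha>\<^sup>2" 1 "(\<beta> k)\<^sup>2 * t k"] by simp
    show "\<alpha>\<^sup>2 \<cdot>\<^sub>m \<Theta> p k = \<sigma> k \<cdot>\<^sub>m 1\<^sub>m M"
      unfolding \<Theta>_def \<Theta>[OF k] \<sigma>_def t_def by (intro eq_matI) auto
    \<comment> \<open>The left side is the variance of a predicted entry, a quadratic form in the
      weights; \<open>normal_eq_form\<close> collapses it to the linear expression defining
      \<sigma>.\<close>
    have form: "\<beta> k * corr_form \<alpha> p (\<lambda>j. \<alpha> * \<beta> k * r k j) + (1 / sqrt pp)\<^sup>2 * (\<Sum>j\<le>p. (\<alpha> * \<beta> k * r k j)\<^sup>2) = \<sigma> k"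
    proof -
      have "corr_form \<alpha> p (\<lambda>j. \<alpha> * \<beta> k * r k j) = (\<alpha> * \<beta> k)\<^sup>2 * corr_form \<alpha> p (r k)"
        by (simp add: corr_form_def sum_distrib_left power2_eq_square mult_ac)
      moreover have "(\<Sum>j\<le>p. (\<alpha> * \<beta> k * r k j)\<^sup>2) = (\<alpha> * \<beta> k)\<^sup>2 * (\<Sum>j\<le>p. (r k j)\<^sup>2)"
        by (simp add: power_mult_distrib sum_distrib_left)
      moreover have "(1 / sqrt pp)\<^sup>2 = 1 / pp" using pp0 by (simp add: power_divide)
      ultimately have "\<beta> k * corr_form \<alpha> p (\<lambda>j. \<alpha> * \<beta> k * r k j) + (1 / sqrt pp)\<^sup>2 * (\<Sum>j\<le>p. (\<alpha> * \<beta> k * r k j)\<^sup>2) =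
          (\<alpha> * \<beta> k)\<^sup>2 * (\<beta> k * corr_form \<alpha> p (r k) + 1 / pp * (\<Sum>j\<le>p. (r k j)\<^sup>2))"
        by (simp only: distrib_left mult_ac)
      then show ?thesis
        using normal_eq_form[OF r[OF k]] by (simp only: \<sigma>_def t_def power_mult_distrib mult.assoc)
    qed
    show "cn_family (\<lambda>m \<omega>. g_pred p k n \<omega> $ m) M (\<sigma> k)"
      by (rule cn_family_cong[OF observation_combination[OF k, where p = p and x = "\<lambda>j. \<alpha> * \<beta> k * r k j"
            and n = "n - 1" and c = "1 / sqrt pp", unfolded form]]) (simp only: pred[OF k])
  next
    let ?U = "UNIV \<times> {..<M}"
    have H: "(\<lambda>f. \<lambda>m\<in>{..<M}. ?h k f m) \<in> (\<Pi>\<^sub>M i\<in>?U. borel) \<Otimes>\<^sub>M (\<Pi>\<^sub>M i\<in>?U. borel) \<rightarrow>\<^sub>M (\<Pi>\<^sub>M m\<in>{..<M}. borel)" for k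
      by (intro measurable_restrict borel_measurable_sum borel_measurable_times borel_measurable_add
          borel_measurable_const measurable_compose[OF measurable_fst] measurable_compose[OF measurable_snd]
          measurable_component_singleton) auto
    show "indep_vars (\<lambda>_. \<Pi>\<^sub>M m\<in>{..<M}. borel) (\<lambda>k \<omega>. \<lambda>m\<in>{..<M}. g_pred p k n \<omega> $ m) {1..K}"
      using users_indep[OF H]
      by (rule indep_vars_cong[THEN iffD1, rotated -1])
        (auto simp: pred fun_eq_iff restrict_def intro!: sum.cong)
  qed
qed

lemma rate_mrc_ge_bound:
  assumes k: "k \<in> {1..K}"
  shows "rate_mrc_bound p k \<le> rate_mrc p k n"
proof -
  obtain \<sigma> where \<sigma>: "\<And>k. k \<in> {1..K} \<Longrightarrow> cn_family (\<lambda>m \<omega>. g_pred p k n \<omega> $ m) M (\<sigma> k)"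
      "\<And>k. k \<in> {1..K} \<Longrightarrow> 0 \<le> \<sigma> k" "\<And>k. k \<in> {1..K} \<Longrightarrow> \<sigma> k \<le> \<beta> k"
      "\<And>k. k \<in> {1..K} \<Longrightarrow> \<alpha>\<^sup>2 \<cdot>\<^sub>m \<Theta> p k = \<sigma> k \<cdot>\<^sub>m 1\<^sub>m M"
    and ind: "indep_vars (\<lambda>_. \<Pi>\<^sub>M m\<in>{..<M}. borel) (\<lambda>k \<omega>. \<lambda>m\<in>{..<M}. g_pred p k n \<omega> $ m) {1..K}"
    by (rule g_pred_law[of p n]) blast
  \<comment> \<open>A user exists and \<open>K \<le> M\<close>, so division by \<open>M\<close> in
    the normalised traces is genuine.\<close>
  have M: "1 \<le> M" using k K_le_M by simp
  have tr: "1 / real M * mtrace (\<alpha>\<^sup>2 \<cdot>\<^sub>m \<Theta> p i) = \<sigma> i" if "i \<in> {1..K}" for i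
    using M by (simp add: \<sigma>(4)[OF that] mtrace_smult_one)
  have tr_err: "1 / real M * mtrace (\<beta> i \<cdot>\<^sub>m 1\<^sub>m M - \<alpha>\<^sup>2 \<cdot>\<^sub>m \<Theta> p i) = \<beta> i - \<sigma> i" if "i \<in> {1..K}" for i
  proof -
    have "\<beta> i \<cdot>\<^sub>m 1\<^sub>m M - \<alpha>\<^sup>2 \<cdot>\<^sub>m \<Theta> p i = (\<beta> i - \<sigma> i) \<cdot>\<^sub>m 1\<^sub>m M"
      unfolding \<sigma>(4)[OF that] by (intro eq_matI) auto
    then show ?thesis using M by (simp add: mtrace_smult_one)
  qed
  \<comment> \<open>Total prediction error power plus unit noise; \<sigma> \<le> \<beta> makes it
    positive.\<close>
  define C where "C = pu * (\<Sum>i\<in>{1..K}. \<beta> i - \<sigma> i) + 1"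
  have C: "0 < C"
    unfolding C_def using \<sigma>(3) pu_pos by (intro add_nonneg_pos mult_nonneg_nonneg sum_nonneg) auto
  have dim: "dim_vec (g_pred p i n \<omega>) = M" for i \<omega>
    by (simp add: g_pred_def q_mat_def kron_def delta_row_def)
  have ip: "g_pred p i n \<omega> \<bullet>c g_pred p k n \<omega> = (\<Sum>m<M. g_pred p i n \<omega> $ m * cnj (g_pred p k n \<omega> $ m))" for i \<omega>
    by (simp add: scalar_prod_def dim lessThan_atLeast0)
  \<comment> \<open>For MRC the useful amplitude is the squared norm itself, so the numerator is its
    square.\<close>
  have self: "(cmod (g_pred p k n \<omega> \<bullet>c g_pred p k n \<omega>))\<^sup>2 = (\<Sum>m<M. (cmod (g_pred p k n \<omega> $ m))\<^sup>2)\<^sup>2" for \<omega>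
  proof -
    have "g_pred p k n \<omega> \<bullet>c g_pred p k n \<omega> = complex_of_real (\<Sum>m<M. (cmod (g_pred p k n \<omega> $ m))\<^sup>2)"
      by (simp only: ip of_real_sum complex_norm_square)
    then show ?thesis by (simp only: norm_of_real power2_abs)
  qed
  have bound: "rate_mrc_bound p k = log 2 (1 + pu * (real M - 1) * \<sigma> k / (pu * (\<Sum>i\<in>{1..K} - {k}. \<sigma> i) + C))"
  proof -
    have "pu * (real M - 1) * (1 / real M) * mtrace (\<alpha>\<^sup>2 \<cdot>\<^sub>m \<Theta> p k) = pu * (real M - 1) * \<sigma> k"
      by (simp only: mult.assoc tr[OF k])
    moreover have "(\<Sum>i\<in>{1..K} - {k}. 1 / real M * mtrace (\<alpha>\<^sup>2 \<cdot>\<^sub>m \<Theta> p i)) = (\<Sum>i\<in>{1..K} - {k}. \<sigma> i)"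
      by (rule sum.cong) (simp_all only: tr Diff_iff)
    ultimately show ?thesis
      by (simp only: rate_mrc_bound_def C_def tr_err add.assoc cong: sum.cong)
  qed
  have sinr: "SINR p k n (g_pred p k n \<omega>) \<omega> = pu * (\<Sum>m<M. (cmod (g_pred p k n \<omega> $ m))\<^sup>2)\<^sup>2 /
      (pu * (\<Sum>i\<in>{1..K} - {k}. (cmod (\<Sum>m<M. g_pred p i n \<omega> $ m * cnj (g_pred p k n \<omega> $ m)))\<^sup>2) +
       (\<Sum>m<M. (cmod (g_pred p k n \<omega> $ m))\<^sup>2) * C)" for \<omega>
    unfolding SINR_def self unfolding ip vec_sq_norm_def dim C_def using tr_err by simp
  show ?thesis
    unfolding rate_mrc_def rate_def bound sinr
    by (rule mrc_rate_bound[where A="\<lambda>i m \<omega>. g_pred p i n \<omega> $ m"])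
      (use k M pu_pos C \<sigma>(1,2) indep_vars_imp_indep_var[OF ind k] in auto)
qed

end

theorem theorem6:
  fixes P :: "'w measure" and M K tau p k :: nat and pu \<alpha> :: real and \<beta> :: "nat \<Rightarrow> real"
    and g e b :: "nat \<Rightarrow> int \<Rightarrow> nat \<Rightarrow> 'w \<Rightarrow> complex" and n :: int
  assumes "uplink P M K tau pu \<alpha> \<beta> g e b"
    and "k \<in> {1..K}"
  shows "uplink.rate_mrc P M K tau pu \<alpha> \<beta> g b p k (n + 1)
           \<ge> uplink.rate_mrc_bound M K tau pu \<alpha> \<beta> p k"
  using assms by (rule uplink.rate_mrc_ge_bound)

end
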